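(* Let $\mathcal{A}$ be an operator ideal, let $X$ be a real Banach space and let $M$ be a complemented subspace of $X$. If $M$ and $X/M$ both have the Lip-$\mathcal{A}$-BAP, then so does $X$.
   Context: All Banach spaces are real. A complemented subspace of $X$ is the range of a bounded linear projection on $X$. For Banach spaces $X,Y$, $\mathcal{L}(X,Y)$ is the space of bounded linear operators, and $\mathrm{Lip}_0(X,Y)$ is the Banach space of Lipschitz maps $f:X\to Y$ with $f(0)=0$, with norm $\|f\|_{\mathrm{Lip}}=\sup_{x\neq y}\|f(x)-f(y)\|/\|x-y\|$; $\mathrm{Lip}_0(X)=\mathrm{Lip}_0(X,\mathbb{R})$. For $x\in X$ let $\delta_x\in \mathrm{Lip}_0(X)^*$, $\delta_x(f)=f(x)$. The Lipschitz-free space is $\mathfrak{F}(X)=\overline{\mathrm{span}}\{\delta_x: x\in X\}\subseteq \mathrm{Lip}_0(X)^*$, and $\delta_X:X\to\mathfrak{F}(X)$, $\delta_X(x)=\delta_x$. For each $f\in\mathrm{Lip}_0(X,Y)$ there is a unique $L_f\in\mathcal{L}(\mathfrak{F}(X),Y)$ with $L_f\delta_X=f$, and $\|L_f\|=\|f\|_{\mathrm{Lip}}$. Operator ideals are (linear) operator ideals in the usual sense. For an operator ideal $\mathcal{A}$ and $\lambda\ge 1$: $\mathrm{Lip}_{\mathcal{A}}(X,Y)=\{f\in\mathrm{Lip}_0(X,Y): L_f\in\mathcal{A}(\mathfrak{F}(X),Y)\}$ and $\mathrm{Lip}_{\mathcal{A}}^\lambda(X,Y)=\{f\in\mathrm{Lip}_{\mathcal{A}}(X,Y):\|f\|_{\mathrm{Lip}}\le\lambda\}$.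 $\tau_c$ denotes the compact-open topology (uniform convergence on compact subsets of the domain). A Banach space $Z$ has the Lip-$\mathcal{A}$-BAP if $\mathrm{Id}_Z\in\overline{\mathrm{Lip}_{\mathcal{A}}^\lambda(Z,Z)}^{\tau_c}$ for some $\lambda\ge1$. *)

theory Defs
  imports "HOL-Analysis.Analysis"
begin

text \<open>
  Subspaces, quotients and Lipschitz-free spaces of one Banach space have to be treated on the same
  footing, and an operator ideal ranges over all Banach spaces, so Banach spaces are structures with
  an explicit carrier set rather than types of class \<open>banach\<close>.  Operators and Lipschitz maps are
  extensional functions on the carrier.
\<close>

record 'a nspace =
  pts :: "'a set"
  zer :: 'a
  add :: "'a \<Rightarrow> 'a \<Rightarrow> 'a"
  scl :: "real \<Rightarrow> 'a \<Rightarrow> 'a"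
  nrm :: "'a \<Rightarrow> real"

definition vsub :: "'a nspace \<Rightarrow> 'a \<Rightarrow> 'a \<Rightarrow> 'a" where
  "vsub E x y = add E x (scl E (- 1) y)"

(* Metric_space requires nonnegativity and symmetry also off the carrier, hence the guard. *)
definition vdist :: "'a nspace \<Rightarrow> 'a \<Rightarrow> 'a \<Rightarrow> real" where
  "vdist E x y = (if x \<in> pts E \<and> y \<in> pts E then nrm E (vsub E x y) else 0)"

abbreviation vtop :: "'a nspace \<Rightarrow> 'a topology" where
  "vtop E \<equiv> Metric_space.mtopology (pts E) (vdist E)"

locale normed_space_on =
  fixes E :: "'a nspace"
  assumes zer_in: "zer E \<in> pts E"
    and add_in: "\<lbrakk>x \<in> pts E; y \<in> pts E\<rbrakk> \<Longrightarrow> add E x y \<in> pts E"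
    and scl_in: "x \<in> pts E \<Longrightarrow> scl E a x \<in> pts E"
    and add_assoc: "\<lbrakk>x \<in> pts E; y \<in> pts E; z \<in> pts E\<rbrakk>
          \<Longrightarrow> add E (add E x y) z = add E x (add E y z)"
    and add_commute: "\<lbrakk>x \<in> pts E; y \<in> pts E\<rbrakk> \<Longrightarrow> add E x y = add E y x"
    and add_zer: "x \<in> pts E \<Longrightarrow> add E x (zer E) = x"
    and add_inv: "x \<in> pts E \<Longrightarrow> add E x (scl E (- 1) x) = zer E"
    and scl_add_right: "\<lbrakk>x \<in> pts E; y \<in> pts E\<rbrakk>
          \<Longrightarrow> scl E a (add E x y) = add E (scl E a x) (scl E a y)"
    and scl_add_left: "x \<in> pts E \<Longrightarrow> scl E (a + b) x = add E (scl E a x) (scl E b x)"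
    and scl_scl: "x \<in> pts E \<Longrightarrow> scl E a (scl E b x) = scl E (a * b) x"
    and scl_one: "x \<in> pts E \<Longrightarrow> scl E 1 x = x"
    and nrm_zero_iff: "x \<in> pts E \<Longrightarrow> nrm E x = 0 \<longleftrightarrow> x = zer E"
    and nrm_scl: "x \<in> pts E \<Longrightarrow> nrm E (scl E a x) = \<bar>a\<bar> * nrm E x"
    and nrm_add: "\<lbrakk>x \<in> pts E; y \<in> pts E\<rbrakk> \<Longrightarrow> nrm E (add E x y) \<le> nrm E x + nrm E y"

locale banach_space_on = normed_space_on +
  assumes complete: "Metric_space.mcomplete (pts E) (vdist E)"

definition real_line :: "real nspace" where
  "real_line = \<lparr>pts = UNIV, zer = 0, add = (+), scl = (*), nrm = abs\<rparr>"

definition linear_subspace :: "'a nspace \<Rightarrow> 'a set \<Rightarrow> bool" where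
  "linear_subspace E S \<longleftrightarrow> S \<subseteq> pts E \<and> zer E \<in> S \<and>
     (\<forall>x\<in>S. \<forall>y\<in>S. add E x y \<in> S) \<and> (\<forall>a. \<forall>x\<in>S. scl E a x \<in> S)"

definition lspan :: "'a nspace \<Rightarrow> 'a set \<Rightarrow> 'a set" where
  "lspan E B = \<Inter>{S. linear_subspace E S \<and> B \<subseteq> S}"

definition subspace_of :: "'a nspace \<Rightarrow> 'a set \<Rightarrow> 'a nspace" where
  "subspace_of E M = E\<lparr>pts := M\<rparr>"

definition coset :: "'a nspace \<Rightarrow> 'a set \<Rightarrow> 'a \<Rightarrow> 'a set" where
  "coset E M x = {add E x m |m. m \<in> M}"

(* Adding M in the scalar multiplication matters only for the scalar 0. *)
definition quotient_space :: "'a nspace \<Rightarrow> 'a set \<Rightarrow> 'a set nspace" where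
  "quotient_space E M =
     \<lparr>pts = coset E M ` pts E,
      zer = M,
      add = (\<lambda>C D. {add E x y |x y. x \<in> C \<and> y \<in> D}),
      scl = (\<lambda>a C. {add E (scl E a x) m |x m. x \<in> C \<and> m \<in> M}),
      nrm = (\<lambda>C. INF x\<in>C. nrm E x)\<rparr>"


subsection \<open>Bounded linear operators\<close>

definition bdd_ops :: "'a nspace \<Rightarrow> 'b nspace \<Rightarrow> ('a \<Rightarrow> 'b) set" where
  "bdd_ops E F = {T \<in> pts E \<rightarrow>\<^sub>E pts F.
     (\<forall>x\<in>pts E. \<forall>y\<in>pts E. T (add E x y) = add F (T x) (T y)) \<and>
     (\<forall>a. \<forall>x\<in>pts E. T (scl E a x) = scl F a (T x)) \<and>
     (\<exists>C. \<forall>x\<in>pts E. nrm F (T x) \<le> C * nrm E x)}"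

definition op_add :: "'a nspace \<Rightarrow> 'b nspace \<Rightarrow> ('a \<Rightarrow> 'b) \<Rightarrow> ('a \<Rightarrow> 'b) \<Rightarrow> 'a \<Rightarrow> 'b" where
  "op_add E F S T = (\<lambda>x\<in>pts E. add F (S x) (T x))"

definition op_scl :: "'a nspace \<Rightarrow> 'b nspace \<Rightarrow> real \<Rightarrow> ('a \<Rightarrow> 'b) \<Rightarrow> 'a \<Rightarrow> 'b" where
  "op_scl E F a T = (\<lambda>x\<in>pts E. scl F a (T x))"

definition op_norm :: "'a nspace \<Rightarrow> 'b nspace \<Rightarrow> ('a \<Rightarrow> 'b) \<Rightarrow> real" where
  "op_norm E F T = (SUP x\<in>{x \<in> pts E. nrm E x \<le> 1}. nrm F (T x))"

definition dual_space :: "'a nspace \<Rightarrow> ('a \<Rightarrow> real) nspace" where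
  "dual_space E =
     \<lparr>pts = bdd_ops E real_line,
      zer = (\<lambda>x\<in>pts E. 0),
      add = op_add E real_line,
      scl = op_scl E real_line,
      nrm = op_norm E real_line\<rparr>"

definition finite_rank :: "'a nspace \<Rightarrow> 'b nspace \<Rightarrow> ('a \<Rightarrow> 'b) \<Rightarrow> bool" where
  "finite_rank E F T \<longleftrightarrow> (\<exists>B. finite B \<and> B \<subseteq> pts F \<and> T ` pts E \<subseteq> lspan F B)"

definition isometric_iso :: "'a nspace \<Rightarrow> 'b nspace \<Rightarrow> ('a \<Rightarrow> 'b) \<Rightarrow> bool" where
  "isometric_iso E F i \<longleftrightarrow> i \<in> bdd_ops E F \<and> bij_betw i (pts E) (pts F) \<and>
     (\<forall>x\<in>pts E. nrm F (i x) = nrm E x)"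

definition complemented_subspace :: "'a nspace \<Rightarrow> 'a set \<Rightarrow> bool" where
  "complemented_subspace E M \<longleftrightarrow>
     (\<exists>P\<in>bdd_ops E E. (\<forall>x\<in>pts E. P (P x) = P x) \<and> P ` pts E = M)"


subsection \<open>Operator ideals\<close>

text \<open>
  HOL has no type of all Banach spaces.  An operator ideal is given on all Banach spaces whose
  points lie in a type \<open>'u\<close>, which plays the role of the universe and is arbitrary.
\<close>

type_synonym 'u op_class = "'u nspace \<Rightarrow> 'u nspace \<Rightarrow> ('u \<Rightarrow> 'u) set"

definition operator_ideal :: "'u op_class \<Rightarrow> bool" where
  "operator_ideal A \<longleftrightarrow>
     (\<forall>E F. banach_space_on E \<and> banach_space_on F \<longrightarrow>
        A E F \<subseteq> bdd_ops E F \<and>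
        (\<forall>T\<in>bdd_ops E F. finite_rank E F T \<longrightarrow> T \<in> A E F) \<and>
        (\<forall>S\<in>A E F. \<forall>T\<in>A E F. op_add E F S T \<in> A E F) \<and>
        (\<forall>a. \<forall>T\<in>A E F. op_scl E F a T \<in> A E F)) \<and>
     (\<forall>D E F G. banach_space_on D \<and> banach_space_on E \<and> banach_space_on F \<and> banach_space_on G \<longrightarrow>
        (\<forall>R\<in>bdd_ops D E. \<forall>T\<in>A E F. \<forall>S\<in>bdd_ops F G.
           compose (pts D) S (compose (pts D) T R) \<in> A D G))"

text \<open>
  The component of the ideal at Banach spaces over other types, obtained by identifying them
  isometrically with spaces over \<open>'u\<close>.  By the ideal property the choice of the identifications does
  not matter.  They exist as soon as \<open>'u\<close> is large enough: if \<open>X\<close> lives on \<open>'a\<close>, an injection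
  \<open>(('a set \<Rightarrow> real) \<Rightarrow> real) \<Rightarrow> 'u\<close> suffices for \<open>X\<close>, its subspaces and quotients, and their
  Lipschitz-free spaces.
\<close>

definition ideal_ops :: "'u op_class \<Rightarrow> 'a nspace \<Rightarrow> 'b nspace \<Rightarrow> ('a \<Rightarrow> 'b) set" where
  "ideal_ops A E F = {T \<in> bdd_ops E F.
     \<exists>E' F' i j. banach_space_on E' \<and> banach_space_on F' \<and>
       isometric_iso E E' i \<and> isometric_iso F F' j \<and>
       (\<exists>T'\<in>A E' F'. \<forall>x\<in>pts E. T' (i x) = j (T x))}"


subsection \<open>Lipschitz maps and the Lipschitz-free space\<close>

definition lip_maps :: "'a nspace \<Rightarrow> 'b nspace \<Rightarrow> ('a \<Rightarrow> 'b) set" where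
  "lip_maps X Y = {f \<in> pts X \<rightarrow>\<^sub>E pts Y. f (zer X) = zer Y \<and>
     (\<exists>C. \<forall>x\<in>pts X. \<forall>y\<in>pts X. vdist Y (f x) (f y) \<le> C * vdist X x y)}"

(* The diagonal contributes 0 / 0 = 0, so the supremum is over a nonempty set even if X is 0. *)
definition lip_norm :: "'a nspace \<Rightarrow> 'b nspace \<Rightarrow> ('a \<Rightarrow> 'b) \<Rightarrow> real" where
  "lip_norm X Y f = (SUP (x, y)\<in>pts X \<times> pts X. vdist Y (f x) (f y) / vdist X x y)"

definition lip_space :: "'a nspace \<Rightarrow> 'b nspace \<Rightarrow> ('a \<Rightarrow> 'b) nspace" where
  "lip_space X Y =
     \<lparr>pts = lip_maps X Y,
      zer = (\<lambda>x\<in>pts X. zer Y),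
      add = op_add X Y,
      scl = op_scl X Y,
      nrm = lip_norm X Y\<rparr>"

definition delta :: "'a nspace \<Rightarrow> 'a \<Rightarrow> ('a \<Rightarrow> real) \<Rightarrow> real" where
  "delta X x = (\<lambda>f\<in>lip_maps X real_line. f x)"

definition free_space :: "'a nspace \<Rightarrow> (('a \<Rightarrow> real) \<Rightarrow> real) nspace" where
  "free_space X = (let D = dual_space (lip_space X real_line) in
     subspace_of D (vtop D closure_of lspan D (delta X ` pts X)))"

definition is_linearization ::
    "'a nspace \<Rightarrow> 'b nspace \<Rightarrow> ('a \<Rightarrow> 'b) \<Rightarrow> ((('a \<Rightarrow> real) \<Rightarrow> real) \<Rightarrow> 'b) \<Rightarrow> bool" where
  "is_linearization X Y f L \<longleftrightarrow>
     L \<in> bdd_ops (free_space X) Y \<and> (\<forall>x\<in>pts X. L (delta X x) = f x)"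

(* The linearization of f exists and is unique, so this says that it belongs to the ideal. *)
definition lip_ideal :: "'u op_class \<Rightarrow> 'a nspace \<Rightarrow> 'b nspace \<Rightarrow> ('a \<Rightarrow> 'b) set" where
  "lip_ideal A X Y = {f \<in> lip_maps X Y.
     \<exists>L. is_linearization X Y f L \<and> L \<in> ideal_ops A (free_space X) Y}"

definition lip_ideal_ball :: "'u op_class \<Rightarrow> real \<Rightarrow> 'a nspace \<Rightarrow> 'b nspace \<Rightarrow> ('a \<Rightarrow> 'b) set" where
  "lip_ideal_ball A r X Y = {f \<in> lip_ideal A X Y. lip_norm X Y f \<le> r}"


subsection \<open>Uniform convergence on compact sets\<close>

definition cont_maps :: "'a nspace \<Rightarrow> 'b nspace \<Rightarrow> ('a \<Rightarrow> 'b) set" where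
  "cont_maps X Y = {f \<in> pts X \<rightarrow>\<^sub>E pts Y. continuous_map (vtop X) (vtop Y) f}"

definition uc_nbhd :: "'a nspace \<Rightarrow> 'b nspace \<Rightarrow> ('a \<Rightarrow> 'b) \<Rightarrow> 'a set \<Rightarrow> real \<Rightarrow> ('a \<Rightarrow> 'b) set" where
  "uc_nbhd X Y f K e = {g \<in> cont_maps X Y. \<forall>x\<in>K. vdist Y (g x) (f x) < e}"

definition tau_c :: "'a nspace \<Rightarrow> 'b nspace \<Rightarrow> ('a \<Rightarrow> 'b) topology" where
  "tau_c X Y = topology (\<lambda>U. U \<subseteq> cont_maps X Y \<and>
     (\<forall>f\<in>U. \<exists>K e. compactin (vtop X) K \<and> 0 < e \<and> uc_nbhd X Y f K e \<subseteq> U))"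

lemma istopology_tau_c:
  "istopology (\<lambda>U. U \<subseteq> cont_maps X Y \<and>
     (\<forall>f\<in>U. \<exists>K e. compactin (vtop X) K \<and> 0 < e \<and> uc_nbhd X Y f K e \<subseteq> U))"
  (is "istopology ?P")
  unfolding istopology_def
proof (intro conjI allI impI)
  fix S T assume S: "?P S" and T: "?P T"
  show "S \<inter> T \<subseteq> cont_maps X Y" using S by blast
  show "\<forall>f\<in>S \<inter> T. \<exists>K e. compactin (vtop X) K \<and> 0 < e \<and> uc_nbhd X Y f K e \<subseteq> S \<inter> T"
  proof
    fix f assume "f \<in> S \<inter> T"
    then obtain K e L d where K: "compactin (vtop X) K" "0 < e" "uc_nbhd X Y f K e \<subseteq> S"
      and L: "compactin (vtop X) L" "0 < d" "uc_nbhd X Y f L d \<subseteq> T"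
      using S T by (metis IntE)
    have "uc_nbhd X Y f (K \<union> L) (min e d) \<subseteq> uc_nbhd X Y f K e \<inter> uc_nbhd X Y f L d"
      by (auto simp: uc_nbhd_def)
    moreover have "compactin (vtop X) (K \<union> L)" "0 < min e d"
      using K L by (simp_all add: compactin_Un)
    ultimately show "\<exists>K e. compactin (vtop X) K \<and> 0 < e \<and> uc_nbhd X Y f K e \<subseteq> S \<inter> T"
      using K(3) L(3) by (meson Int_mono order_trans)
  qed
next
  fix \<K> assume P: "\<forall>U\<in>\<K>. ?P U"
  show "\<Union>\<K> \<subseteq> cont_maps X Y" using P by blast
  show "\<forall>f\<in>\<Union>\<K>. \<exists>K e. compactin (vtop X) K \<and> 0 < e \<and> uc_nbhd X Y f K e \<subseteq> \<Union>\<K>"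
  proof
    fix f assume "f \<in> \<Union>\<K>"
    then obtain U where U: "U \<in> \<K>" "f \<in> U" by blast
    then obtain K e where "compactin (vtop X) K" "0 < e" "uc_nbhd X Y f K e \<subseteq> U"
      using P by metis
    then show "\<exists>K e. compactin (vtop X) K \<and> 0 < e \<and> uc_nbhd X Y f K e \<subseteq> \<Union>\<K>"
      using U(1) by (meson Union_upper order_trans)
  qed
qed

definition lip_bap :: "'u op_class \<Rightarrow> 'a nspace \<Rightarrow> bool" where
  "lip_bap A Z \<longleftrightarrow>
     (\<exists>r\<ge>1. (\<lambda>x\<in>pts Z. x) \<in> tau_c Z Z closure_of lip_ideal_ball A r Z Z)"

end

theory Submission
  imports Defs
begin

text \<open>
  Write \<open>P\<close> for the projection onto \<open>M\<close> and \<open>q : X \<rightarrow> X/M\<close> for the quotient map.  Since \<open>M\<close> is the kernel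
  of \<open>Id - P\<close>, this operator factors through the quotient as \<open>Id - P = S q\<close> with \<open>S\<close> bounded, so the
  identity of \<open>X\<close> is the sum of an operator through \<open>M\<close> and one through \<open>X/M\<close>:
  \<open>x = P x + S (q x)\<close>.  If \<open>f\<close> and \<open>g\<close> are Lipschitz maps of the ideal that are close to the
  identities of \<open>M\<close> and \<open>X/M\<close> on the compact sets \<open>P(K)\<close> and \<open>q(K)\<close>, then \<open>h = f P + S g q\<close> is close
  to the identity of \<open>X\<close> on \<open>K\<close>, and its Lipschitz norm is at most \<open>\<parallel>f\<parallel> \<parallel>P\<parallel> + \<parallel>S\<parallel> \<parallel>g\<parallel> \<parallel>q\<parallel>\<close>, whatever \<open>K\<close> is.
  This is \<open>lip_bap_of_decomposition\<close>, for any two spaces through which the identity of \<open>X\<close>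
  decomposes.

  That \<open>h\<close> is again in the ideal comes from the functoriality of the Lipschitz-free space: a Lipschitz
  map \<open>R : X \<rightarrow> Y\<close> extends to an operator \<open>\<FF>(X) \<rightarrow> \<FF>(Y)\<close> (\<open>free_map\<close>), so the linearization of
  \<open>S f R\<close> is the composition of this operator, the linearization of \<open>f\<close>, and \<open>S\<close>
  (\<open>lip_ideal_compose\<close>); sums are linearized by sums (\<open>lip_ideal_add\<close>).

  The ideal only sees spaces over the type \<open>'u\<close>, through isometric copies.  To use its closure
  properties, \<open>X\<close> and \<open>\<FF>(X)\<close> need copies over \<open>'u\<close> that are Banach spaces; this is where the
  completeness of the dual of a normed space enters, because \<open>\<FF>(X)\<close> is a closed subspace of one.
\<close>

section \<open>Normed spaces on a carrier\<close>

context normed_space_on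
begin

lemma scl_zero: assumes "x \<in> pts E" shows "scl E 0 x = zer E"
  using scl_add_left[OF assms, of 1 "- 1"] by (simp add: scl_one add_inv assms)

lemma nrm_zer: "nrm E (zer E) = 0"
  by (simp add: nrm_zero_iff zer_in)

lemma nrm_nonneg: assumes "x \<in> pts E" shows "0 \<le> nrm E x"
proof -
  have "nrm E (add E x (scl E (- 1) x)) \<le> nrm E x + nrm E (scl E (- 1) x)"
    by (intro nrm_add assms scl_in)
  then show ?thesis
    by (simp add: add_inv nrm_zer nrm_scl assms)
qed

lemma zer_add: "x \<in> pts E \<Longrightarrow> add E (zer E) x = x"
  by (metis add_commute add_zer zer_in)

lemma add_left_commute:
  "\<lbrakk>x \<in> pts E; y \<in> pts E; z \<in> pts E\<rbrakk> \<Longrightarrow> add E x (add E y z) = add E y (add E x z)"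
  by (metis add_assoc add_commute)

lemma add_add_add_swap:
  "\<lbrakk>x \<in> pts E; y \<in> pts E; z \<in> pts E; w \<in> pts E\<rbrakk>
    \<Longrightarrow> add E (add E x y) (add E z w) = add E (add E x z) (add E y w)"
  by (simp add: add_assoc add_left_commute[of y z w] add_in)

lemma scl_zer: "scl E a (zer E) = zer E"
  by (metis mult_zero_right scl_scl scl_zero zer_in)

lemma inv_add: "x \<in> pts E \<Longrightarrow> add E (scl E (- 1) x) x = zer E"
  by (metis add_commute add_inv scl_in)

lemma vsub_in: "\<lbrakk>x \<in> pts E; y \<in> pts E\<rbrakk> \<Longrightarrow> vsub E x y \<in> pts E"
  by (simp add: vsub_def add_in scl_in)

lemma vsub_add_cancel: "\<lbrakk>x \<in> pts E; y \<in> pts E\<rbrakk> \<Longrightarrow> add E (vsub E x y) y = x"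
  by (simp add: vsub_def add_assoc scl_in inv_add add_zer)

lemma add_vsub_cancel: "\<lbrakk>x \<in> pts E; y \<in> pts E\<rbrakk> \<Longrightarrow> add E x (vsub E y x) = y"
  by (metis add_commute vsub_add_cancel vsub_in)

lemma vsub_self: "x \<in> pts E \<Longrightarrow> vsub E x x = zer E"
  by (simp add: vsub_def add_inv)

lemma vsub_zer: "x \<in> pts E \<Longrightarrow> vsub E x (zer E) = x"
  by (simp add: vsub_def scl_zer add_zer)

lemma vsub_eq_zer_iff: "\<lbrakk>x \<in> pts E; y \<in> pts E\<rbrakk> \<Longrightarrow> vsub E x y = zer E \<longleftrightarrow> x = y"
  by (metis vsub_add_cancel vsub_self zer_add)

lemma vsub_swap:
  assumes "x \<in> pts E" "y \<in> pts E"
  shows "vsub E y x = scl E (- 1) (vsub E x y)"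
  using assms by (simp add: vsub_def scl_add_right scl_in scl_scl scl_one) (metis add_commute scl_in)

lemma vsub_trans:
  assumes "x \<in> pts E" "y \<in> pts E" "z \<in> pts E"
  shows "add E (vsub E x y) (vsub E y z) = vsub E x z"
  using assms by (simp add: vsub_def add_assoc add_in scl_in)
    (metis add_assoc scl_in inv_add zer_add)

lemma vsub_add_add:
  assumes "x \<in> pts E" "y \<in> pts E" "z \<in> pts E" "w \<in> pts E"
  shows "vsub E (add E x y) (add E z w) = add E (vsub E x z) (vsub E y w)"
  using assms by (simp add: vsub_def scl_add_right scl_in add_add_add_swap)

lemma vdist_eq: "\<lbrakk>x \<in> pts E; y \<in> pts E\<rbrakk> \<Longrightarrow> vdist E x y = nrm E (vsub E x y)"
  by (simp add: vdist_def)

lemma vdist_zer: "x \<in> pts E \<Longrightarrow> vdist E x (zer E) = nrm E x"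
  by (simp add: vdist_eq zer_in vsub_zer)

lemma vdist_add_add:
  assumes "x \<in> pts E" "y \<in> pts E" "z \<in> pts E" "w \<in> pts E"
  shows "vdist E (add E x y) (add E z w) \<le> vdist E x z + vdist E y w"
  using assms by (simp add: vdist_eq add_in vsub_add_add nrm_add vsub_in)

lemma Metric_space_vdist: "Metric_space (pts E) (vdist E)"
proof
  show "0 \<le> vdist E x y" for x y
    by (simp add: vdist_def nrm_nonneg vsub_in)
  show "vdist E x y = vdist E y x" for x y
    using vsub_swap[of x y] by (simp add: vdist_def nrm_scl vsub_in)
  show "vdist E x y = 0 \<longleftrightarrow> x = y" if "x \<in> pts E" "y \<in> pts E" for x y
    using that by (simp add: vdist_eq nrm_zero_iff vsub_in vsub_eq_zer_iff)
  show "vdist E x z \<le> vdist E x y + vdist E y z"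
    if "x \<in> pts E" "y \<in> pts E" "z \<in> pts E" for x y z
    using that nrm_add[of "vsub E x y" "vsub E y z"] by (simp add: vdist_eq vsub_in vsub_trans)
qed

end

sublocale normed_space_on \<subseteq> Metric_space "pts E" "vdist E"
  by (rule Metric_space_vdist)

lemma banach_space_onI:
  fixes E :: "'a nspace"
  assumes "normed_space_on E"
    and "\<And>\<sigma> :: nat \<Rightarrow> 'a. \<lbrakk>\<And>n. \<sigma> n \<in> pts E; \<And>e. 0 < e \<Longrightarrow> \<exists>N. \<forall>m\<ge>N. \<forall>n\<ge>N. vdist E (\<sigma> m) (\<sigma> n) < e\<rbrakk>
           \<Longrightarrow> \<exists>x\<in>pts E. \<forall>e>0. \<exists>N. \<forall>n\<ge>N. vdist E (\<sigma> n) x < e"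
  shows "banach_space_on E"
proof -
  interpret normed_space_on E by fact
  have "\<exists>x. limitin mtopology \<sigma> x sequentially" if "MCauchy \<sigma>" for \<sigma>
  proof -
    have "\<sigma> n \<in> pts E" for n using that by (auto simp: MCauchy_def)
    moreover have "\<exists>N. \<forall>m\<ge>N. \<forall>n\<ge>N. vdist E (\<sigma> m) (\<sigma> n) < e" if "0 < e" for e
      using \<open>MCauchy \<sigma>\<close> that by (simp add: MCauchy_def)
    ultimately show ?thesis
      using assms(2)[of \<sigma>] by (auto simp: limit_metric_sequentially)
  qed
  then show ?thesis
    by unfold_locales (auto simp: mcomplete_def)
qed

lemma (in banach_space_on) Cauchy_converges:
  fixes \<sigma> :: "nat \<Rightarrow> 'a"
  assumes "\<And>n. \<sigma> n \<in> pts E"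
    and "\<And>e. 0 < e \<Longrightarrow> \<exists>N. \<forall>m\<ge>N. \<forall>n\<ge>N. vdist E (\<sigma> m) (\<sigma> n) < e"
  obtains x where "x \<in> pts E" "\<And>e. 0 < e \<Longrightarrow> \<exists>N. \<forall>n\<ge>N. vdist E (\<sigma> n) x < e"
proof -
  have "MCauchy \<sigma>"
    using assms by (auto simp: MCauchy_def)
  then show ?thesis
    using complete that by (metis limit_metric_sequentially mcomplete_def)
qed

lemma subspace_of_simps [simp]:
  "pts (subspace_of E S) = S" "zer (subspace_of E S) = zer E" "add (subspace_of E S) = add E"
  "scl (subspace_of E S) = scl E" "nrm (subspace_of E S) = nrm E"
  by (simp_all add: subspace_of_def)

lemma vdist_subspace_of:
  "\<lbrakk>S \<subseteq> pts E; x \<in> S; y \<in> S\<rbrakk> \<Longrightarrow> vdist (subspace_of E S) x y = vdist E x y"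
  by (auto simp: vdist_def vsub_def)

lemma normed_space_on_subspace_of:
  assumes "normed_space_on E" "linear_subspace E S"
  shows "normed_space_on (subspace_of E S)"
proof -
  interpret normed_space_on E by fact
  have sub: "x \<in> pts E" if "x \<in> S" for x
    using assms(2) that by (auto simp: linear_subspace_def)
  show ?thesis
    using assms(2)
    by unfold_locales
      (simp_all add: linear_subspace_def sub add_assoc add_zer add_inv scl_add_right scl_add_left
        scl_scl scl_one nrm_zero_iff nrm_scl nrm_add, simp add: add_commute sub)
qed

lemma banach_space_on_subspace_of:
  fixes E :: "'a nspace"
  assumes "banach_space_on E" "linear_subspace E S" and closed: "vtop E closure_of S \<subseteq> S"
  shows "banach_space_on (subspace_of E S)"
proof (rule banach_space_onI)
  interpret banach_space_on E by fact
  have S: "S \<subseteq> pts E" using assms(2) by (simp add: linear_subspace_def)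
  show "normed_space_on (subspace_of E S)"
    by (intro normed_space_on_subspace_of normed_space_on_axioms assms(2))
  fix \<sigma> :: "nat \<Rightarrow> 'a"
  assume \<sigma>: "\<And>n. \<sigma> n \<in> pts (subspace_of E S)"
    and cau: "\<And>e. 0 < e \<Longrightarrow> \<exists>N. \<forall>m\<ge>N. \<forall>n\<ge>N. vdist (subspace_of E S) (\<sigma> m) (\<sigma> n) < e"
  obtain x where x: "x \<in> pts E" and lim: "\<And>e. 0 < e \<Longrightarrow> \<exists>N. \<forall>n\<ge>N. vdist E (\<sigma> n) x < e"
  proof (rule Cauchy_converges[of \<sigma>])
    show "\<sigma> n \<in> pts E" for n using \<sigma> S by auto
    show "\<exists>N. \<forall>m\<ge>N. \<forall>n\<ge>N. vdist E (\<sigma> m) (\<sigma> n) < e" if "0 < e" for e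
      using cau[OF that] \<sigma> S by (simp add: vdist_subspace_of)
  qed (use that in blast)
  have "x \<in> mtopology closure_of S"
    unfolding metric_closure_of
  proof safe
    fix r :: real assume "0 < r"
    then obtain N where "vdist E (\<sigma> N) x < r" using lim by blast
    then show "\<exists>y\<in>S. y \<in> mball x r"
      using \<sigma> S x by (intro bexI[of _ "\<sigma> N"]) (auto simp: commute)
  qed (fact x)
  then have "x \<in> S" using closed by blast
  then show "\<exists>x\<in>pts (subspace_of E S). \<forall>e>0. \<exists>N. \<forall>n\<ge>N. vdist (subspace_of E S) (\<sigma> n) x < e"
    using lim \<sigma> S by (auto simp: vdist_subspace_of intro!: bexI[of _ x])
qed

section \<open>Bounded linear operators\<close>

lemma bdd_opsD:
  assumes "T \<in> bdd_ops E F"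
  shows "T \<in> pts E \<rightarrow>\<^sub>E pts F"
    and "x \<in> pts E \<Longrightarrow> T x \<in> pts F"
    and "\<lbrakk>x \<in> pts E; y \<in> pts E\<rbrakk> \<Longrightarrow> T (add E x y) = add F (T x) (T y)"
    and "x \<in> pts E \<Longrightarrow> T (scl E a x) = scl F a (T x)"
  using assms by (auto simp: bdd_ops_def)

lemma bdd_opsI:
  assumes "T \<in> pts E \<rightarrow>\<^sub>E pts F"
    and "\<And>x y. \<lbrakk>x \<in> pts E; y \<in> pts E\<rbrakk> \<Longrightarrow> T (add E x y) = add F (T x) (T y)"
    and "\<And>a x. x \<in> pts E \<Longrightarrow> T (scl E a x) = scl F a (T x)"
    and "\<And>x. x \<in> pts E \<Longrightarrow> nrm F (T x) \<le> C * nrm E x"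
  shows "T \<in> bdd_ops E F"
  using assms unfolding bdd_ops_def by blast

lemma bdd_ops_bound:
  assumes "normed_space_on E" "T \<in> bdd_ops E F"
  obtains C where "0 \<le> C" "\<And>x. x \<in> pts E \<Longrightarrow> nrm F (T x) \<le> C * nrm E x"
proof -
  interpret normed_space_on E by fact
  obtain C where C: "\<And>x. x \<in> pts E \<Longrightarrow> nrm F (T x) \<le> C * nrm E x"
    using assms(2) unfolding bdd_ops_def by blast
  have "nrm F (T x) \<le> \<bar>C\<bar> * nrm E x" if "x \<in> pts E" for x
    using C[OF that] mult_right_mono[OF abs_ge_self[of C] nrm_nonneg[OF that]] by linarith
  then show ?thesis using that[of "\<bar>C\<bar>"] by auto
qed

lemma bdd_ops_zer:
  assumes "normed_space_on E" "normed_space_on F" "T \<in> bdd_ops E F"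
  shows "T (zer E) = zer F"
  by (metis assms bdd_opsD(2,4) normed_space_on.scl_zero normed_space_on.zer_in)

lemma bdd_ops_vsub:
  assumes "normed_space_on E" "T \<in> bdd_ops E F" "x \<in> pts E" "y \<in> pts E"
  shows "T (vsub E x y) = vsub F (T x) (T y)"
  using assms by (simp add: vsub_def bdd_opsD normed_space_on.scl_in)

lemma bdd_ops_vdist:
  assumes "normed_space_on E" "T \<in> bdd_ops E F"
  obtains C where "0 \<le> C"
    "\<And>x y. \<lbrakk>x \<in> pts E; y \<in> pts E\<rbrakk> \<Longrightarrow> vdist F (T x) (T y) \<le> C * vdist E x y"
proof -
  interpret normed_space_on E by fact
  obtain C where "0 \<le> C" "\<And>x. x \<in> pts E \<Longrightarrow> nrm F (T x) \<le> C * nrm E x"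
    using bdd_ops_bound[OF assms] by blast
  then show ?thesis
    using assms
    by (intro that[of C]) (simp_all add: vdist_def vsub_in bdd_opsD(2) flip: bdd_ops_vsub)
qed

lemma bdd_ops_compose:
  assumes "normed_space_on D" "normed_space_on E" "R \<in> bdd_ops D E" "T \<in> bdd_ops E F"
  shows "compose (pts D) T R \<in> bdd_ops D F"
proof -
  interpret D: normed_space_on D by fact
  obtain C where C: "0 \<le> C" "\<And>x. x \<in> pts D \<Longrightarrow> nrm E (R x) \<le> C * nrm D x"
    using bdd_ops_bound[OF assms(1,3)] by blast
  obtain B where B: "0 \<le> B" "\<And>x. x \<in> pts E \<Longrightarrow> nrm F (T x) \<le> B * nrm E x"
    using bdd_ops_bound[OF assms(2,4)] by blast
  show ?thesis
  proof (rule bdd_opsI[where C = "B * C"])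
    show "compose (pts D) T R \<in> pts D \<rightarrow>\<^sub>E pts F"
      using assms(3,4) by (auto simp: compose_def bdd_opsD)
    show "nrm F (compose (pts D) T R x) \<le> B * C * nrm D x" if "x \<in> pts D" for x
    proof -
      have "nrm F (T (R x)) \<le> B * nrm E (R x)" by (simp add: B bdd_opsD[OF assms(3)] that)
      also have "\<dots> \<le> B * (C * nrm D x)" by (intro mult_left_mono C B that)
      finally show ?thesis by (simp add: compose_def that)
    qed
  qed (simp_all add: compose_def D.add_in D.scl_in bdd_opsD[OF assms(3)] bdd_opsD[OF assms(4)])
qed

lemma bdd_ops_add:
  assumes "normed_space_on E" "normed_space_on F" "S \<in> bdd_ops E F" "T \<in> bdd_ops E F"
  shows "op_add E F S T \<in> bdd_ops E F"
proof -
  interpret E: normed_space_on E by fact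
  interpret F: normed_space_on F by fact
  note S = bdd_opsD[OF assms(3)] and T = bdd_opsD[OF assms(4)]
  obtain C where C: "\<And>x. x \<in> pts E \<Longrightarrow> nrm F (S x) \<le> C * nrm E x"
    using bdd_ops_bound[OF assms(1,3)] by blast
  obtain B where B: "\<And>x. x \<in> pts E \<Longrightarrow> nrm F (T x) \<le> B * nrm E x"
    using bdd_ops_bound[OF assms(1,4)] by blast
  show ?thesis
  proof (rule bdd_opsI[where C = "C + B"])
    show "nrm F (op_add E F S T x) \<le> (C + B) * nrm E x" if "x \<in> pts E" for x
      using F.nrm_add[of "S x" "T x"] C[OF that] B[OF that] that
      by (simp add: op_add_def S T distrib_right)
  qed (auto simp: op_add_def S T E.add_in E.scl_in F.add_in F.add_add_add_swap F.scl_add_right)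
qed

lemma isometric_iso_inverse:
  assumes "normed_space_on E" "isometric_iso E F i"
  shows "(\<lambda>y\<in>pts F. inv_into (pts E) i y) \<in> bdd_ops F E"
proof -
  interpret normed_space_on E by fact
  have i: "i \<in> bdd_ops E F" and bij: "bij_betw i (pts E) (pts F)"
    and nrm: "\<And>x. x \<in> pts E \<Longrightarrow> nrm F (i x) = nrm E x"
    using assms(2) by (auto simp: isometric_iso_def)
  have inv: "inv_into (pts E) i (i x) = x" if "x \<in> pts E" for x
    using bij that by (simp add: bij_betw_inv_into_left)
  have F: "\<exists>x\<in>pts E. y = i x" if "y \<in> pts F" for y
    using bij that by (auto simp: bij_betw_def)
  have inj: "i x = i y \<longleftrightarrow> x = y" if "x \<in> pts E" "y \<in> pts E" for x y
    using bij that by (auto simp: bij_betw_def inj_on_eq_iff)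
  note iD = bdd_opsD[OF i]
  have i_add: "add F (i x) (i y) = i (add E x y)" if "x \<in> pts E" "y \<in> pts E" for x y
    using that by (simp add: iD)
  have i_scl: "scl F a (i x) = i (scl E a x)" if "x \<in> pts E" for a x
    using that by (simp add: iD)
  show ?thesis
  proof (rule bdd_opsI[where C = 1])
    show "(\<lambda>y\<in>pts F. inv_into (pts E) i y) \<in> pts F \<rightarrow>\<^sub>E pts E"
      using F inv by (auto dest!: F)
  qed (auto dest!: F simp: i_add i_scl iD(2) inv inj add_in scl_in nrm simp del: iD(3,4))
qed

lemma bdd_ops_restrict:
  assumes "T \<in> bdd_ops E F" "linear_subspace E S" "T ` S \<subseteq> S'"
  shows "restrict T S \<in> bdd_ops (subspace_of E S) (subspace_of F S')"
proof -
  have S: "x \<in> pts E" if "x \<in> S" for x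
    using assms(2) that by (auto simp: linear_subspace_def)
  obtain C where "\<And>x. x \<in> pts E \<Longrightarrow> nrm F (T x) \<le> C * nrm E x"
    using assms(1) unfolding bdd_ops_def by blast
  then show ?thesis
    using assms(2,3)
    by (intro bdd_opsI[where C = C]) (auto simp: linear_subspace_def S bdd_opsD[OF assms(1)])
qed

text \<open>
  The preimage of a linear subspace under a linear map is a linear subspace, and the
  span is the intersection of all subspaces containing the given set.
\<close>

lemma bdd_ops_lspan:
  assumes "normed_space_on E" "normed_space_on F" "T \<in> bdd_ops E F" "B \<subseteq> pts E" "T ` B \<subseteq> C"
  shows "T ` lspan E B \<subseteq> lspan F C"
proof
  interpret E: normed_space_on E by fact
  fix y assume "y \<in> T ` lspan E B"
  then obtain x where x: "x \<in> lspan E B" "y = T x" by blast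
  show "y \<in> lspan F C"
    unfolding lspan_def
  proof safe
    fix S assume S: "linear_subspace F S" "C \<subseteq> S"
    have "linear_subspace E {x \<in> pts E. T x \<in> S}"
      using S(1) by (auto simp: linear_subspace_def E.zer_in E.add_in E.scl_in
          bdd_ops_zer[OF assms(1-3)] bdd_opsD[OF assms(3)])
    moreover have "B \<subseteq> {x \<in> pts E. T x \<in> S}" using assms(4,5) S(2) by auto
    ultimately show "y \<in> S" using x by (auto simp: lspan_def)
  qed
qed

lemma lspan_superset: "B \<subseteq> lspan E B"
  by (auto simp: lspan_def)

lemma linear_subspace_lspan:
  assumes "normed_space_on E" "B \<subseteq> pts E"
  shows "linear_subspace E (lspan E B)"
proof -
  interpret normed_space_on E by fact
  have "linear_subspace E (pts E)"
    by (simp add: linear_subspace_def zer_in add_in scl_in)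
  then have "lspan E B \<subseteq> pts E"
    using assms(2) by (auto simp: lspan_def)
  then show ?thesis
    by (simp add: linear_subspace_def) (auto simp: lspan_def linear_subspace_def)
qed

lemma linear_subspace_closure:
  assumes "normed_space_on E" "linear_subspace E S"
  shows "linear_subspace E (vtop E closure_of S)"
proof -
  interpret normed_space_on E by fact
  have S: "S \<subseteq> pts E" using assms(2) by (simp add: linear_subspace_def)
  have cl: "x \<in> mtopology closure_of S \<longleftrightarrow> x \<in> pts E \<and> (\<forall>r>0. \<exists>y\<in>S. vdist E x y < r)" for x
    using S by (auto simp: metric_closure_of) (meson subsetD)+
  show ?thesis
    unfolding linear_subspace_def
  proof (intro conjI ballI allI)
    show "mtopology closure_of S \<subseteq> pts E" by (auto simp: cl)
    show "zer E \<in> mtopology closure_of S"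
      using assms(2) S by (metis closure_of_subset linear_subspace_def subsetD topspace_mtopology)
  next
    fix x y assume x: "x \<in> mtopology closure_of S" and y: "y \<in> mtopology closure_of S"
    have "\<exists>z\<in>S. vdist E (add E x y) z < r" if "0 < r" for r
    proof -
      obtain x' where "x' \<in> S" "vdist E x x' < r / 2"
        using x \<open>0 < r\<close> half_gt_zero unfolding cl by blast
      moreover obtain y' where "y' \<in> S" "vdist E y y' < r / 2"
        using y \<open>0 < r\<close> half_gt_zero unfolding cl by blast
      moreover from calculation have "add E x' y' \<in> S" using assms(2) by (simp add: linear_subspace_def)
      ultimately show ?thesis
        using vdist_add_add[of x y x' y'] x y subsetD[OF S, of x'] subsetD[OF S, of y']
        by (intro bexI[of _ "add E x' y'"]) (auto simp: cl)
    qed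
    then show "add E x y \<in> mtopology closure_of S"
      using x y by (simp add: cl add_in)
  next
    fix a x assume x: "x \<in> mtopology closure_of S"
    have "\<exists>z\<in>S. vdist E (scl E a x) z < r" if "0 < r" for r
    proof -
      have "0 < r / (\<bar>a\<bar> + 1)" using that by simp
      then obtain x' where x': "x' \<in> S" "vdist E x x' < r / (\<bar>a\<bar> + 1)"
        using x by (auto simp: cl)
      have xp: "x \<in> pts E" "x' \<in> pts E" using x x' S by (auto simp: cl)
      then have "vsub E (scl E a x) (scl E a x') = scl E a (vsub E x x')"
        by (simp add: vsub_def scl_add_right scl_in scl_scl)
      then have "vdist E (scl E a x) (scl E a x') = \<bar>a\<bar> * vdist E x x'"
        using xp by (simp add: vdist_eq scl_in nrm_scl vsub_in)
      also have "\<dots> \<le> (\<bar>a\<bar> + 1) * vdist E x x'" by (simp add: mult_right_mono)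
      also have "\<dots> < r" using x'(2) by (simp add: field_simps)
      finally show ?thesis
        using x'(1) assms(2) by (intro bexI[of _ "scl E a x'"]) (auto simp: linear_subspace_def)
    qed
    then show "scl E a x \<in> mtopology closure_of S"
      using x by (simp add: cl scl_in)
  qed
qed

section \<open>Copies of a space on another type\<close>

text \<open>
  Copies are needed to move spaces into the type on which an operator ideal is given.
\<close>

definition transport_space :: "('a \<Rightarrow> 'b) \<Rightarrow> 'a nspace \<Rightarrow> 'b nspace" where
  "transport_space k E = (let l = inv_into (pts E) k in
     \<lparr>pts = k ` pts E, zer = k (zer E), add = (\<lambda>u v. k (add E (l u) (l v))),
      scl = (\<lambda>a u. k (scl E a (l u))), nrm = (\<lambda>u. nrm E (l u))\<rparr>)"

lemma
  fixes E :: "'a nspace" and k :: "'a \<Rightarrow> 'b"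
  assumes "banach_space_on E" "inj k"
  shows banach_space_on_transport_space: "banach_space_on (transport_space k E)"
    and isometric_iso_transport_space:
      "isometric_iso E (transport_space k E) (restrict k (pts E))"
proof -
  interpret banach_space_on E by fact
  let ?F = "transport_space k E"
  have k: "k x = k y \<longleftrightarrow> x = y" for x y
    using assms(2) by (simp add: inj_eq)
  have l: "inv_into (pts E) k (k x) = x" if "x \<in> pts E" for x
    using that assms(2) by (meson inj_on_subset inv_into_f_f subset_UNIV)
  note tr = transport_space_def Let_def l k
  have norm: "normed_space_on ?F"
  proof unfold_locales
    show "add ?F x y = add ?F y x" if "x \<in> pts ?F" "y \<in> pts ?F" for x y
      using that by (auto simp: tr intro: add_commute)
  qed (auto simp: tr zer_in add_in scl_in add_assoc add_zer add_inv scl_add_right scl_add_left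
      scl_scl scl_one nrm_zero_iff nrm_scl nrm_add)
  have dist: "vdist ?F (k x) (k y) = vdist E x y" if "x \<in> pts E" "y \<in> pts E" for x y
    using that by (simp add: vdist_def vsub_def tr add_in scl_in)
  show "isometric_iso E ?F (restrict k (pts E))"
    unfolding isometric_iso_def
  proof (intro conjI)
    show "restrict k (pts E) \<in> bdd_ops E ?F"
      by (rule bdd_opsI[where C = 1]) (auto simp: tr add_in scl_in)
    show "bij_betw (restrict k (pts E)) (pts E) (pts ?F)"
      by (auto simp: bij_betw_def inj_on_def tr)
  qed (simp add: tr)
  show "banach_space_on ?F"
  proof (rule banach_space_onI[OF norm])
    fix \<sigma> :: "nat \<Rightarrow> 'b"
    assume \<sigma>: "\<And>n. \<sigma> n \<in> pts ?F"
      and cau: "\<And>e. 0 < e \<Longrightarrow> \<exists>N. \<forall>m\<ge>N. \<forall>n\<ge>N. vdist ?F (\<sigma> m) (\<sigma> n) < e"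
    have "\<exists>x\<in>pts E. \<sigma> n = k x" for n using \<sigma>[of n] by (auto simp: tr)
    then obtain \<tau> where \<tau>: "\<And>n. \<tau> n \<in> pts E" "\<And>n. \<sigma> n = k (\<tau> n)" by metis
    obtain x where "x \<in> pts E" "\<And>e. 0 < e \<Longrightarrow> \<exists>N. \<forall>n\<ge>N. vdist E (\<tau> n) x < e"
    proof (rule Cauchy_converges[of \<tau>])
      show "\<exists>N. \<forall>m\<ge>N. \<forall>n\<ge>N. vdist E (\<tau> m) (\<tau> n) < e" if "0 < e" for e
        using cau[OF that] by (simp add: \<tau> dist)
    qed (use \<tau>(1) that in blast)+
    then show "\<exists>x\<in>pts ?F. \<forall>e>0. \<exists>N. \<forall>n\<ge>N. vdist ?F (\<sigma> n) x < e"
      by (intro bexI[of _ "k x"]) (auto simp: \<tau> dist, simp add: tr)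
  qed
qed

section \<open>Lipschitz functions, dual spaces and Lipschitz-free spaces\<close>

lemma normed_space_on_real_line: "normed_space_on real_line"
  by unfold_locales (auto simp: real_line_def algebra_simps abs_mult abs_triangle_ineq)

lemma real_line_simps [simp]:
  "pts real_line = UNIV" "zer real_line = 0" "add real_line = (+)" "scl real_line = (*)"
  "nrm real_line = abs" "vdist real_line a b = \<bar>a - b\<bar>"
  by (simp_all add: real_line_def vdist_def vsub_def)

text \<open>
  The dual of a normed space and the space of real Lipschitz functions are both spaces of real
  functions, normed by the least constant in a family of inequalities
  \<open>\<bar>\<phi>\<^sub>k f\<bar> \<le> C w\<^sub>k\<close> with linear functionals \<open>\<phi>\<^sub>k\<close>: the evaluations in the first case, the
  differences \<open>f x - f y\<close> in the second.  Every such norm satisfies the norm axioms.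
\<close>

lemma normed_space_on_least_constant:
  fixes S :: "'i set" and ev :: "'k \<Rightarrow> ('i \<Rightarrow> real) \<Rightarrow> real"
  assumes E: "zer E = (\<lambda>x\<in>S. 0)" "add E = (\<lambda>f g. \<lambda>x\<in>S. f x + g x)"
      "scl E = (\<lambda>a f. \<lambda>x\<in>S. a * f x)"
    and ext: "pts E \<subseteq> extensional S" and zer: "zer E \<in> pts E"
    and add: "\<And>f g. \<lbrakk>f \<in> pts E; g \<in> pts E\<rbrakk> \<Longrightarrow> add E f g \<in> pts E"
    and scl: "\<And>a f. f \<in> pts E \<Longrightarrow> scl E a f \<in> pts E"
    and ev_add: "\<And>k f g. \<lbrakk>k \<in> J; f \<in> pts E; g \<in> pts E\<rbrakk> \<Longrightarrow> ev k (add E f g) = ev k f + ev k g"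
    and ev_scl: "\<And>k a f. \<lbrakk>k \<in> J; f \<in> pts E\<rbrakk> \<Longrightarrow> ev k (scl E a f) = a * ev k f"
    and sep: "\<And>f. \<lbrakk>f \<in> pts E; \<And>k. k \<in> J \<Longrightarrow> ev k f = 0\<rbrakk> \<Longrightarrow> f = zer E"
    and w: "\<And>k. k \<in> J \<Longrightarrow> 0 \<le> w k"
    and nonneg: "\<And>f. f \<in> pts E \<Longrightarrow> 0 \<le> nrm E f"
    and bound: "\<And>k f. \<lbrakk>k \<in> J; f \<in> pts E\<rbrakk> \<Longrightarrow> \<bar>ev k f\<bar> \<le> nrm E f * w k"
    and least: "\<And>f C. \<lbrakk>f \<in> pts E; 0 \<le> C; \<And>k. k \<in> J \<Longrightarrow> \<bar>ev k f\<bar> \<le> C * w k\<rbrakk> \<Longrightarrow> nrm E f \<le> C"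
  shows "normed_space_on E"
proof
  have eqI: "f = g" if "f \<in> pts E" "g \<in> pts E" "\<And>x. x \<in> S \<Longrightarrow> f x = g x" for f g
    using ext that by (meson extensionalityI subsetD)
  show "add E (add E f g) h = add E f (add E g h)"
    if "f \<in> pts E" "g \<in> pts E" "h \<in> pts E" for f g h
    using that by (intro eqI add) (auto simp: E)
  show "add E f g = add E g f" if "f \<in> pts E" "g \<in> pts E" for f g
    using that by (intro eqI add) (auto simp: E)
  show "add E f (zer E) = f" if "f \<in> pts E" for f
    using that by (intro eqI add zer) (auto simp: E)
  show "add E f (scl E (- 1) f) = zer E" if "f \<in> pts E" for f
    using that by (intro eqI add scl zer) (auto simp: E)
  show "scl E a (add E f g) = add E (scl E a f) (scl E a g)"
    if "f \<in> pts E" "g \<in> pts E" for a f g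
    using that by (intro eqI add scl) (auto simp: E distrib_left)
  show "scl E (a + b) f = add E (scl E a f) (scl E b f)" if "f \<in> pts E" for a b f
    using that by (intro eqI add scl) (auto simp: E distrib_right)
  show "scl E a (scl E b f) = scl E (a * b) f" if "f \<in> pts E" for a b f
    using that by (intro eqI scl) (auto simp: E)
  show one: "scl E 1 f = f" if "f \<in> pts E" for f
    using that by (intro eqI scl) (auto simp: E)
  have ev_zer: "ev k (zer E) = 0" if "k \<in> J" for k
    using ev_scl[OF that zer, of 0] by (simp add: E cong: restrict_cong)
  show "nrm E f = 0 \<longleftrightarrow> f = zer E" if "f \<in> pts E" for f
  proof
    assume "nrm E f = 0"
    then show "f = zer E" using bound[OF _ that] by (intro sep that) auto
  next
    assume "f = zer E"
    then show "nrm E f = 0"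
      using least[OF that, of 0] nonneg[OF that] by (simp add: ev_zer)
  qed
  show "nrm E (add E f g) \<le> nrm E f + nrm E g" if fg: "f \<in> pts E" "g \<in> pts E" for f g
  proof (rule least)
    show "\<bar>ev k (add E f g)\<bar> \<le> (nrm E f + nrm E g) * w k" if "k \<in> J" for k
      using bound[OF that fg(1)] bound[OF that fg(2)] by (simp add: ev_add that fg distrib_right)
  qed (use fg in \<open>simp_all add: add nonneg\<close>)
  have le: "nrm E (scl E a f) \<le> \<bar>a\<bar> * nrm E f" if f: "f \<in> pts E" for a f
  proof (rule least)
    show "\<bar>ev k (scl E a f)\<bar> \<le> (\<bar>a\<bar> * nrm E f) * w k" if "k \<in> J" for k
      using mult_left_mono[OF bound[OF that f], of "\<bar>a\<bar>"] by (simp add: ev_scl that f abs_mult mult.assoc)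
  qed (use f in \<open>simp_all add: scl nonneg\<close>)
  show "nrm E (scl E a f) = \<bar>a\<bar> * nrm E f" if f: "f \<in> pts E" for a f
  proof (cases "a = 0")
    case True
    then show ?thesis using le[OF f, of a] nonneg[OF scl[OF f], of a] by simp
  next
    case False
    have "f = scl E (inverse a) (scl E a f)"
      using False f by (intro eqI scl) (auto simp: E)
    then have "nrm E f \<le> \<bar>inverse a\<bar> * nrm E (scl E a f)"
      using le[OF scl[OF f], of "inverse a" a] by simp
    then show ?thesis
      using le[OF f, of a] False by (simp add: field_simps)
  qed
qed (simp_all add: zer add scl)

lemma lip_mapsD:
  assumes "f \<in> lip_maps X Y"
  shows "f \<in> pts X \<rightarrow>\<^sub>E pts Y" and "x \<in> pts X \<Longrightarrow> f x \<in> pts Y" and "f (zer X) = zer Y"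
  using assms by (auto simp: lip_maps_def)

lemma lip_mapsI:
  assumes "f \<in> pts X \<rightarrow>\<^sub>E pts Y" "f (zer X) = zer Y"
    and "\<And>x y. \<lbrakk>x \<in> pts X; y \<in> pts X\<rbrakk> \<Longrightarrow> vdist Y (f x) (f y) \<le> C * vdist X x y"
  shows "f \<in> lip_maps X Y"
  using assms unfolding lip_maps_def by blast

text \<open>
  A real supremum means something only for bounded sets; the Lipschitz condition bounds the
  difference quotients, and the quotient \<open>0 / 0 = 0\<close> at the origin shows that the supremum is not
  negative.
\<close>

lemma
  assumes "normed_space_on X" "normed_space_on Y" "f \<in> lip_maps X Y"
  shows lip_norm_nonneg: "0 \<le> lip_norm X Y f"
    and lip_norm_bound: "\<lbrakk>x \<in> pts X; y \<in> pts X\<rbrakk>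
          \<Longrightarrow> vdist Y (f x) (f y) \<le> lip_norm X Y f * vdist X x y"
proof -
  interpret X: normed_space_on X by fact
  interpret Y: normed_space_on Y by fact
  let ?q = "\<lambda>(x, y). vdist Y (f x) (f y) / vdist X x y"
  obtain C where C: "\<And>x y. \<lbrakk>x \<in> pts X; y \<in> pts X\<rbrakk> \<Longrightarrow> vdist Y (f x) (f y) \<le> C * vdist X x y"
    using assms(3) unfolding lip_maps_def by blast
  have "?q p \<le> \<bar>C\<bar>" if "p \<in> pts X \<times> pts X" for p
  proof -
    obtain x y where p: "p = (x, y)" "x \<in> pts X" "y \<in> pts X" using \<open>p \<in> _\<close> by auto
    show ?thesis
    proof (cases "x = y")
      case True
      then show ?thesis using p by (simp add: X.nonneg)
    next
      case False
      then have "0 < vdist X x y" using p by (simp add: X.mdist_pos_eq)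
      moreover have "vdist Y (f x) (f y) \<le> \<bar>C\<bar> * vdist X x y"
        using C[OF p(2,3)] mult_right_mono[OF abs_ge_self[of C] X.nonneg[of x y]] by linarith
      ultimately show ?thesis using p by (simp add: divide_le_eq)
    qed
  qed
  then have bdd: "bdd_above (?q ` (pts X \<times> pts X))" by (rule bdd_aboveI2)
  have up: "?q (x, y) \<le> lip_norm X Y f" if "x \<in> pts X" "y \<in> pts X" for x y
    unfolding lip_norm_def using that by (intro cSUP_upper bdd) auto
  show "0 \<le> lip_norm X Y f"
    using up[OF X.zer_in X.zer_in] by (simp add: X.mdist_zero X.zer_in)
  show "vdist Y (f x) (f y) \<le> lip_norm X Y f * vdist X x y" if "x \<in> pts X" "y \<in> pts X" for x y
  proof (cases "x = y")
    case True
    then show ?thesis using that by (simp add: X.mdist_zero Y.mdist_zero lip_mapsD[OF assms(3)])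
  next
    case False
    then have "0 < vdist X x y" using that by (simp add: X.mdist_pos_eq)
    then show ?thesis using up[OF that] by (simp add: divide_le_eq)
  qed
qed

lemma lip_norm_least:
  assumes "normed_space_on X" "0 \<le> C"
    and "\<And>x y. \<lbrakk>x \<in> pts X; y \<in> pts X\<rbrakk> \<Longrightarrow> vdist Y (f x) (f y) \<le> C * vdist X x y"
  shows "lip_norm X Y f \<le> C"
  unfolding lip_norm_def
proof (rule cSUP_least)
  interpret normed_space_on X by fact
  show "pts X \<times> pts X \<noteq> {}" using zer_in by blast
  fix p assume "p \<in> pts X \<times> pts X"
  then obtain x y where p: "p = (x, y)" "x \<in> pts X" "y \<in> pts X" by auto
  then show "(case p of (x, y) \<Rightarrow> vdist Y (f x) (f y) / vdist X x y) \<le> C"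
    using assms(2) assms(3)[of x y] nonneg[of x y] by (cases "vdist X x y = 0") (auto simp: divide_le_eq)
qed

lemma normed_space_on_lip_space:
  assumes "normed_space_on X"
  shows "normed_space_on (lip_space X real_line)"
proof -
  interpret normed_space_on X by fact
  note bd = lip_norm_bound[OF assms normed_space_on_real_line, simplified]
  show ?thesis
  proof (rule normed_space_on_least_constant[where S = "pts X" and J = "pts X \<times> pts X"
        and ev = "\<lambda>p f. f (fst p) - f (snd p)" and w = "\<lambda>p. vdist X (fst p) (snd p)"])
    show "pts (lip_space X real_line) \<subseteq> extensional (pts X)"
      by (auto simp: lip_space_def lip_maps_def PiE_def)
    show "zer (lip_space X real_line) \<in> pts (lip_space X real_line)"
      by (auto simp: lip_space_def zer_in intro!: lip_mapsI[where C = 0])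
    show "add (lip_space X real_line) f g \<in> pts (lip_space X real_line)"
      if "f \<in> pts (lip_space X real_line)" "g \<in> pts (lip_space X real_line)" for f g
    proof -
      have fg: "f \<in> lip_maps X real_line" "g \<in> lip_maps X real_line"
        using that by (simp_all add: lip_space_def)
      have "op_add X real_line f g \<in> lip_maps X real_line"
      proof (rule lip_mapsI[where C = "lip_norm X real_line f + lip_norm X real_line g"])
        show "vdist real_line (op_add X real_line f g x) (op_add X real_line f g y)
            \<le> (lip_norm X real_line f + lip_norm X real_line g) * vdist X x y"
          if "x \<in> pts X" "y \<in> pts X" for x y
          using bd[OF fg(1) that] bd[OF fg(2) that] that by (simp add: op_add_def distrib_right)
      qed (use lip_mapsD(3)[OF fg(1)] lip_mapsD(3)[OF fg(2)] in \<open>auto simp: op_add_def zer_in\<close>)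
      then show ?thesis by (simp add: lip_space_def)
    qed
    show "scl (lip_space X real_line) a f \<in> pts (lip_space X real_line)"
      if "f \<in> pts (lip_space X real_line)" for a f
    proof -
      have f: "f \<in> lip_maps X real_line" using that by (simp add: lip_space_def)
      have "op_scl X real_line a f \<in> lip_maps X real_line"
      proof (rule lip_mapsI[where C = "\<bar>a\<bar> * lip_norm X real_line f"])
        show "vdist real_line (op_scl X real_line a f x) (op_scl X real_line a f y)
            \<le> (\<bar>a\<bar> * lip_norm X real_line f) * vdist X x y"
          if "x \<in> pts X" "y \<in> pts X" for x y
          using mult_left_mono[OF bd[OF f that], of "\<bar>a\<bar>"] that
          by (simp add: op_scl_def mult.assoc flip: abs_mult right_diff_distrib)
      qed (use lip_mapsD(3)[OF f] in \<open>auto simp: op_scl_def zer_in\<close>)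
      then show ?thesis by (simp add: lip_space_def)
    qed
    show "f = zer (lip_space X real_line)"
      if "f \<in> pts (lip_space X real_line)" "\<And>k. k \<in> pts X \<times> pts X \<Longrightarrow> f (fst k) - f (snd k) = 0" for f
    proof -
      have f: "f \<in> lip_maps X real_line" using that by (simp add: lip_space_def)
      have "f x = 0" if "x \<in> pts X" for x
        using that(1) \<open>\<And>k. k \<in> pts X \<times> pts X \<Longrightarrow> _\<close>[of "(x, zer X)"] lip_mapsD(3)[OF f] zer_in by simp
      then show ?thesis
        using lip_mapsD(1)[OF f] by (auto simp: lip_space_def PiE_def intro: extensionalityI)
    qed
  qed (auto simp: lip_space_def op_add_def op_scl_def fun_eq_iff algebra_simps bd
      lip_norm_nonneg[OF assms normed_space_on_real_line]
      intro!: lip_norm_least[OF assms])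
qed

lemma
  assumes "normed_space_on E" "normed_space_on F" "T \<in> bdd_ops E F"
  shows op_norm_nonneg: "0 \<le> op_norm E F T"
    and op_norm_bound: "x \<in> pts E \<Longrightarrow> nrm F (T x) \<le> op_norm E F T * nrm E x"
proof -
  interpret E: normed_space_on E by fact
  interpret F: normed_space_on F by fact
  note T = bdd_opsD[OF assms(3)]
  obtain C where C: "0 \<le> C" "\<And>x. x \<in> pts E \<Longrightarrow> nrm F (T x) \<le> C * nrm E x"
    using bdd_ops_bound[OF assms(1,3)] by blast
  have "nrm F (T x) \<le> C" if "x \<in> {x \<in> pts E. nrm E x \<le> 1}" for x
    using C(2)[of x] mult_left_mono[OF _ C(1), of "nrm E x" 1] that by simp
  then have bdd: "bdd_above ((\<lambda>x. nrm F (T x)) ` {x \<in> pts E. nrm E x \<le> 1})"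
    by (rule bdd_aboveI2)
  have up: "nrm F (T x) \<le> op_norm E F T" if "x \<in> pts E" "nrm E x \<le> 1" for x
    unfolding op_norm_def using that by (intro cSUP_upper bdd) auto
  show "0 \<le> op_norm E F T"
    using up[OF E.zer_in] by (simp add: E.nrm_zer bdd_ops_zer[OF assms] F.nrm_zer)
  show "nrm F (T x) \<le> op_norm E F T * nrm E x" if x: "x \<in> pts E"
  proof (cases "nrm E x = 0")
    case True
    then show ?thesis using C(2)[OF x] by simp
  next
    case False
    then have pos: "0 < nrm E x" using E.nrm_nonneg[OF x] by simp
    have "nrm F (T (scl E (1 / nrm E x) x)) \<le> op_norm E F T"
      using pos x by (intro up) (simp_all add: E.scl_in E.nrm_scl)
    then show ?thesis using pos by (simp add: T x F.nrm_scl field_simps)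
  qed
qed

lemma op_norm_least:
  assumes "normed_space_on E" "0 \<le> C" "\<And>x. x \<in> pts E \<Longrightarrow> nrm F (T x) \<le> C * nrm E x"
  shows "op_norm E F T \<le> C"
  unfolding op_norm_def
proof (rule cSUP_least)
  interpret normed_space_on E by fact
  show "{x \<in> pts E. nrm E x \<le> 1} \<noteq> {}" using zer_in nrm_zer by force
  show "nrm F (T x) \<le> C" if "x \<in> {x \<in> pts E. nrm E x \<le> 1}" for x
    using assms(3)[of x] mult_left_mono[OF _ assms(2), of "nrm E x" 1] that by simp
qed

lemma normed_space_on_dual_space:
  assumes "normed_space_on E"
  shows "normed_space_on (dual_space E)"
proof -
  interpret normed_space_on E by fact
  note R = normed_space_on_real_line
  show ?thesis
  proof (rule normed_space_on_least_constant[where S = "pts E" and J = "pts E"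
        and ev = "\<lambda>x T. T x" and w = "nrm E"])
    show "pts (dual_space E) \<subseteq> extensional (pts E)"
      by (auto simp: dual_space_def bdd_ops_def PiE_def)
    show "zer (dual_space E) \<in> pts (dual_space E)"
      by (auto simp: dual_space_def add_in scl_in intro!: bdd_opsI[where C = 0])
    show "add (dual_space E) f g \<in> pts (dual_space E)"
      if "f \<in> pts (dual_space E)" "g \<in> pts (dual_space E)" for f g
      using that bdd_ops_add[OF assms R] by (simp add: dual_space_def)
    show "scl (dual_space E) a f \<in> pts (dual_space E)" if "f \<in> pts (dual_space E)" for a f
    proof -
      have f: "f \<in> bdd_ops E real_line" using that by (simp add: dual_space_def)
      have "op_scl E real_line a f \<in> bdd_ops E real_line"
      proof (rule bdd_opsI[where C = "\<bar>a\<bar> * op_norm E real_line f"])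
        show "nrm real_line (op_scl E real_line a f x) \<le> \<bar>a\<bar> * op_norm E real_line f * nrm E x"
          if "x \<in> pts E" for x
          using mult_left_mono[OF op_norm_bound[OF assms R f that], of "\<bar>a\<bar>"] that
          by (simp add: op_scl_def abs_mult mult.assoc)
      qed (auto simp: op_scl_def add_in scl_in bdd_opsD[OF f] algebra_simps)
      then show ?thesis by (simp add: dual_space_def)
    qed
    show "f = zer (dual_space E)"
      if "f \<in> pts (dual_space E)" "\<And>x. x \<in> pts E \<Longrightarrow> f x = 0" for f
      using that by (auto simp: dual_space_def bdd_ops_def PiE_def intro: extensionalityI)
  qed (use op_norm_nonneg[OF assms R] op_norm_bound[OF assms R] op_norm_least[OF assms, of _ real_line] in
      \<open>auto simp: dual_space_def op_add_def op_scl_def fun_eq_iff nrm_nonneg\<close>)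
qed

lemma dual_space_simps [simp]:
  "pts (dual_space E) = bdd_ops E real_line" "nrm (dual_space E) = op_norm E real_line"
  "add (dual_space E) = op_add E real_line" "scl (dual_space E) = op_scl E real_line"
  by (simp_all add: dual_space_def)

lemma vsub_dual_space: "x \<in> pts E \<Longrightarrow> vsub (dual_space E) S T x = S x - T x"
  by (simp add: vsub_def op_add_def op_scl_def)

lemma
  assumes E: "normed_space_on E" and ST: "S \<in> bdd_ops E real_line" "T \<in> bdd_ops E real_line"
  shows vdist_dual_space: "x \<in> pts E \<Longrightarrow> \<bar>S x - T x\<bar> \<le> vdist (dual_space E) S T * nrm E x"
    and vdist_dual_space_least:
      "\<lbrakk>0 \<le> C; \<And>x. x \<in> pts E \<Longrightarrow> \<bar>S x - T x\<bar> \<le> C * nrm E x\<rbrakk> \<Longrightarrow> vdist (dual_space E) S T \<le> C"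
proof -
  interpret D: normed_space_on "dual_space E" by (rule normed_space_on_dual_space[OF E])
  have V: "vsub (dual_space E) S T \<in> bdd_ops E real_line" using D.vsub_in[of S T] ST by simp
  have d: "vdist (dual_space E) S T = op_norm E real_line (vsub (dual_space E) S T)"
    using D.vdist_eq[of S T] ST by simp
  show "x \<in> pts E \<Longrightarrow> \<bar>S x - T x\<bar> \<le> vdist (dual_space E) S T * nrm E x"
    using op_norm_bound[OF E normed_space_on_real_line V, of x] by (simp add: d vsub_dual_space)
  show "vdist (dual_space E) S T \<le> C"
    if "0 \<le> C" "\<And>x. x \<in> pts E \<Longrightarrow> \<bar>S x - T x\<bar> \<le> C * nrm E x"
    unfolding d using that by (intro op_norm_least[OF E]) (simp_all add: vsub_dual_space)
qed

text \<open>
  A Cauchy sequence of functionals converges pointwise.  The inequality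
  \<open>\<bar>\<sigma>\<^sub>m x - \<sigma>\<^sub>n x\<bar> \<le> e \<parallel>x\<parallel>\<close> holds with the same \<open>e\<close> for all \<open>x\<close> and survives the limit
  \<open>n \<rightarrow> \<infinity>\<close>, which makes the pointwise limit bounded and the convergence uniform on the unit ball.
\<close>

lemma banach_space_on_dual_space:
  fixes E :: "'a nspace"
  assumes "normed_space_on E"
  shows "banach_space_on (dual_space E)"
proof (rule banach_space_onI)
  interpret normed_space_on E by fact
  let ?D = "dual_space E"
  interpret D: normed_space_on ?D by (rule normed_space_on_dual_space[OF assms])
  show "normed_space_on ?D" by (rule D.normed_space_on_axioms)
  fix \<sigma> :: "nat \<Rightarrow> 'a \<Rightarrow> real"
  assume "\<And>n. \<sigma> n \<in> pts ?D"
  then have \<sigma>: "\<sigma> n \<in> bdd_ops E real_line" for n by simp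
  assume cau: "\<And>e. 0 < e \<Longrightarrow> \<exists>N. \<forall>m\<ge>N. \<forall>n\<ge>N. vdist ?D (\<sigma> m) (\<sigma> n) < e"
  have ptwise: "\<exists>N. \<forall>m\<ge>N. \<forall>n\<ge>N. \<forall>x\<in>pts E. \<bar>\<sigma> m x - \<sigma> n x\<bar> \<le> e * nrm E x" if e: "0 < e" for e
  proof -
    obtain N where N: "\<And>m n. \<lbrakk>N \<le> m; N \<le> n\<rbrakk> \<Longrightarrow> vdist ?D (\<sigma> m) (\<sigma> n) < e"
      using cau[OF e] by blast
    have "\<bar>\<sigma> m x - \<sigma> n x\<bar> \<le> e * nrm E x" if "N \<le> m" "N \<le> n" "x \<in> pts E" for m n x
      using vdist_dual_space[OF assms \<sigma> \<sigma> that(3), of m n]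
        mult_right_mono[OF less_imp_le[OF N[OF that(1,2)]] nrm_nonneg[OF that(3)]] by linarith
    then show ?thesis by blast
  qed
  define T where "T = (\<lambda>x\<in>pts E. lim (\<lambda>n. \<sigma> n x))"
  have lim: "(\<lambda>n. \<sigma> n x) \<longlonglongrightarrow> T x" if x: "x \<in> pts E" for x
  proof -
    have "Cauchy (\<lambda>n. \<sigma> n x)"
    proof (rule metric_CauchyI)
      fix e :: real assume "0 < e"
      then have "0 < e / (nrm E x + 1)" using nrm_nonneg[OF x] by simp
      from ptwise[OF this] obtain N where
        N: "\<And>m n. \<lbrakk>N \<le> m; N \<le> n\<rbrakk> \<Longrightarrow> \<bar>\<sigma> m x - \<sigma> n x\<bar> \<le> e / (nrm E x + 1) * nrm E x"
        using x by blast
      have "e / (nrm E x + 1) * nrm E x < e"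
        using nrm_nonneg[OF x] \<open>0 < e\<close> by (simp add: field_simps)
      then show "\<exists>N. \<forall>m\<ge>N. \<forall>n\<ge>N. dist (\<sigma> m x) (\<sigma> n x) < e"
        using N by (auto simp: dist_real_def intro!: exI[of _ N] intro: le_less_trans)
    qed
    then show ?thesis
      using x by (simp add: T_def Cauchy_convergent_iff convergent_LIMSEQ_iff)
  qed
  have close: "\<exists>N. \<forall>m\<ge>N. \<forall>x\<in>pts E. \<bar>\<sigma> m x - T x\<bar> \<le> e * nrm E x" if e: "0 < e" for e
  proof -
    obtain N where N: "\<And>m n x. \<lbrakk>N \<le> m; N \<le> n; x \<in> pts E\<rbrakk> \<Longrightarrow> \<bar>\<sigma> m x - \<sigma> n x\<bar> \<le> e * nrm E x"
      using ptwise[OF e] by blast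
    have "\<bar>\<sigma> m x - T x\<bar> \<le> e * nrm E x" if "N \<le> m" "x \<in> pts E" for m x
    proof (rule LIMSEQ_le_const2)
      show "(\<lambda>n. \<bar>\<sigma> m x - \<sigma> n x\<bar>) \<longlonglongrightarrow> \<bar>\<sigma> m x - T x\<bar>"
        by (intro tendsto_intros lim that)
    qed (use N that in blast)
    then show ?thesis by blast
  qed
  have T: "T \<in> bdd_ops E real_line"
  proof -
    obtain N where N: "\<And>x. x \<in> pts E \<Longrightarrow> \<bar>\<sigma> N x - T x\<bar> \<le> 1 * nrm E x"
      using close[of 1] by auto
    show ?thesis
    proof (rule bdd_opsI[where C = "op_norm E real_line (\<sigma> N) + 1"])
      show "T \<in> pts E \<rightarrow>\<^sub>E pts real_line" by (simp add: T_def)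
      show "T (add E x y) = add real_line (T x) (T y)" if "x \<in> pts E" "y \<in> pts E" for x y
        using that lim[of "add E x y"] tendsto_add[OF lim[of x] lim[of y]]
        by (simp add: add_in bdd_opsD[OF \<sigma>] LIMSEQ_unique)
      show "T (scl E a x) = scl real_line a (T x)" if "x \<in> pts E" for a x
        using that lim[of "scl E a x"] tendsto_mult_left[OF lim[of x], of a]
        by (simp add: scl_in bdd_opsD[OF \<sigma>] LIMSEQ_unique)
      show "nrm real_line (T x) \<le> (op_norm E real_line (\<sigma> N) + 1) * nrm E x" if "x \<in> pts E" for x
        using N[OF that] op_norm_bound[OF assms normed_space_on_real_line \<sigma>[of N] that]
        by (simp add: distrib_right)
    qed
  qed
  have "\<exists>N. \<forall>n\<ge>N. vdist ?D (\<sigma> n) T < e" if "0 < e" for e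
  proof -
    obtain N where N: "\<And>n x. \<lbrakk>N \<le> n; x \<in> pts E\<rbrakk> \<Longrightarrow> \<bar>\<sigma> n x - T x\<bar> \<le> e / 2 * nrm E x"
      using close[of "e / 2"] \<open>0 < e\<close> by auto
    have "vdist ?D (\<sigma> n) T \<le> e / 2" if "N \<le> n" for n
      using N[OF that] \<open>0 < e\<close> by (intro vdist_dual_space_least[OF assms \<sigma> T]) auto
    then show ?thesis using \<open>0 < e\<close> by (intro exI[of _ N]) force
  qed
  then show "\<exists>x\<in>pts ?D. \<forall>e>0. \<exists>N. \<forall>n\<ge>N. vdist ?D (\<sigma> n) x < e"
    using T by auto
qed

definition adjoint :: "'a nspace \<Rightarrow> 'b nspace \<Rightarrow> ('a \<Rightarrow> 'b) \<Rightarrow> ('b \<Rightarrow> real) \<Rightarrow> 'a \<Rightarrow> real" where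
  "adjoint E F T = (\<lambda>\<phi>\<in>bdd_ops F real_line. compose (pts E) \<phi> T)"

lemma adjoint_bdd_ops:
  assumes "normed_space_on E" "normed_space_on F" "T \<in> bdd_ops E F"
  shows "adjoint E F T \<in> bdd_ops (dual_space F) (dual_space E)"
proof -
  interpret E: normed_space_on E by fact
  interpret F: normed_space_on F by fact
  interpret F': normed_space_on "dual_space F" by (rule normed_space_on_dual_space) fact
  note T = bdd_opsD[OF assms(3)]
  obtain C where C: "0 \<le> C" "\<And>x. x \<in> pts E \<Longrightarrow> nrm F (T x) \<le> C * nrm E x"
    using bdd_ops_bound[OF assms(1,3)] by blast
  show ?thesis
  proof (rule bdd_opsI[where C = C])
    show "adjoint E F T \<in> pts (dual_space F) \<rightarrow>\<^sub>E pts (dual_space E)"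
      using bdd_ops_compose[OF assms] by (auto simp: adjoint_def)
    show "adjoint E F T (add (dual_space F) \<phi> \<psi>) = add (dual_space E) (adjoint E F T \<phi>) (adjoint E F T \<psi>)"
      if "\<phi> \<in> pts (dual_space F)" "\<psi> \<in> pts (dual_space F)" for \<phi> \<psi>
      using that F'.add_in[OF that] by (auto simp: adjoint_def op_add_def compose_def T fun_eq_iff)
    show "adjoint E F T (scl (dual_space F) a \<phi>) = scl (dual_space E) a (adjoint E F T \<phi>)"
      if "\<phi> \<in> pts (dual_space F)" for a \<phi>
      using that F'.scl_in[OF that, of a] by (auto simp: adjoint_def op_scl_def compose_def T fun_eq_iff)
    show "nrm (dual_space E) (adjoint E F T \<phi>) \<le> C * nrm (dual_space F) \<phi>"
      if "\<phi> \<in> pts (dual_space F)" for \<phi>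
    proof -
      have \<phi>: "\<phi> \<in> bdd_ops F real_line" using that by simp
      note nn = op_norm_nonneg[OF assms(2) normed_space_on_real_line \<phi>]
      have "\<bar>\<phi> (T x)\<bar> \<le> C * op_norm F real_line \<phi> * nrm E x" if x: "x \<in> pts E" for x
        using op_norm_bound[OF assms(2) normed_space_on_real_line \<phi> T(2)[OF x]]
          mult_left_mono[OF C(2)[OF x] nn] by (simp add: mult_ac)
      then have "op_norm E real_line (compose (pts E) \<phi> T) \<le> C * op_norm F real_line \<phi>"
        using C(1) nn by (intro op_norm_least[OF assms(1)]) (auto simp: compose_def)
      then show ?thesis using \<phi> by (simp add: adjoint_def)
    qed
  qed
qed

lemma lip_space_simps [simp]:
  "pts (lip_space X Y) = lip_maps X Y" "nrm (lip_space X Y) = lip_norm X Y"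
  "add (lip_space X Y) = op_add X Y" "scl (lip_space X Y) = op_scl X Y"
  by (simp_all add: lip_space_def)

lemma bdd_ops_lip_maps:
  assumes "normed_space_on X" "normed_space_on Y" "T \<in> bdd_ops X Y"
  shows "T \<in> lip_maps X Y"
proof -
  obtain C where "\<And>x y. \<lbrakk>x \<in> pts X; y \<in> pts X\<rbrakk> \<Longrightarrow> vdist Y (T x) (T y) \<le> C * vdist X x y"
    using bdd_ops_vdist[OF assms(1,3)] by blast
  then show ?thesis
    by (intro lip_mapsI[where C = C] bdd_ops_zer[OF assms] bdd_opsD(1)[OF assms(3)])
qed

lemma
  assumes "normed_space_on X" "normed_space_on Y" "normed_space_on Z"
    and R: "R \<in> lip_maps X Y" and f: "f \<in> lip_maps Y Z"
  shows lip_maps_compose: "compose (pts X) f R \<in> lip_maps X Z"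
    and lip_norm_compose: "lip_norm X Z (compose (pts X) f R) \<le> lip_norm Y Z f * lip_norm X Y R"
proof -
  interpret X: normed_space_on X by fact
  let ?C = "lip_norm Y Z f * lip_norm X Y R"
  have le: "vdist Z (f (R x)) (f (R y)) \<le> ?C * vdist X x y" if "x \<in> pts X" "y \<in> pts X" for x y
  proof -
    have "vdist Z (f (R x)) (f (R y)) \<le> lip_norm Y Z f * vdist Y (R x) (R y)"
      by (intro lip_norm_bound[OF assms(2,3) f] lip_mapsD[OF R] that)
    also have "\<dots> \<le> lip_norm Y Z f * (lip_norm X Y R * vdist X x y)"
      by (intro mult_left_mono lip_norm_bound[OF assms(1,2) R] lip_norm_nonneg[OF assms(2,3) f] that)
    finally show ?thesis by simp
  qed
  show "compose (pts X) f R \<in> lip_maps X Z"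
    using le lip_mapsD[OF R] lip_mapsD[OF f]
    by (intro lip_mapsI[where C = ?C]) (auto simp: compose_def X.zer_in)
  show "lip_norm X Z (compose (pts X) f R) \<le> ?C"
    using le by (intro lip_norm_least[OF assms(1)])
      (auto simp: compose_def lip_norm_nonneg[OF assms(1,2) R] lip_norm_nonneg[OF assms(2,3) f])
qed

lemma lip_maps_continuous:
  assumes "normed_space_on X" "normed_space_on Y" "f \<in> lip_maps X Y"
  shows "continuous_map (vtop X) (vtop Y) f"
proof -
  interpret X: normed_space_on X by fact
  interpret Y: normed_space_on Y by fact
  let ?C = "lip_norm X Y f + 1"
  have C: "0 < ?C" using lip_norm_nonneg[OF assms] by simp
  have "vdist Y (f a) (f x) < e" if "a \<in> pts X" "x \<in> pts X" "vdist X a x < e / ?C" for a x e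
  proof -
    have "vdist Y (f a) (f x) \<le> lip_norm X Y f * vdist X a x"
      by (rule lip_norm_bound[OF assms that(1,2)])
    also have "\<dots> \<le> ?C * vdist X a x" by (simp add: mult_right_mono X.nonneg)
    also have "\<dots> < e" using that(3) C by (simp add: field_simps)
    finally show ?thesis .
  qed
  moreover have "0 < e / ?C" if "0 < e" for e using C that by simp
  ultimately show ?thesis
    using lip_mapsD(2)[OF assms(3)]
    unfolding X.metric_continuous_map[OF Y.Metric_space_axioms] by (meson image_subsetI)
qed

definition precomp :: "'a nspace \<Rightarrow> 'b nspace \<Rightarrow> ('a \<Rightarrow> 'b) \<Rightarrow> ('b \<Rightarrow> real) \<Rightarrow> 'a \<Rightarrow> real" where
  "precomp X Y R = (\<lambda>h\<in>lip_maps Y real_line. compose (pts X) h R)"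

lemma precomp_bdd_ops:
  assumes "normed_space_on X" "normed_space_on Y" "R \<in> lip_maps X Y"
  shows "precomp X Y R \<in> bdd_ops (lip_space Y real_line) (lip_space X real_line)"
proof -
  interpret L: normed_space_on "lip_space Y real_line"
    by (rule normed_space_on_lip_space) fact
  note R = lip_mapsD[OF assms(3)]
  show ?thesis
  proof (rule bdd_opsI[where C = "lip_norm X Y R"])
    show "precomp X Y R \<in> pts (lip_space Y real_line) \<rightarrow>\<^sub>E pts (lip_space X real_line)"
      using lip_maps_compose[OF assms(1,2) normed_space_on_real_line assms(3)]
      by (auto simp: precomp_def)
    show "precomp X Y R (add (lip_space Y real_line) f g)
        = add (lip_space X real_line) (precomp X Y R f) (precomp X Y R g)"
      if "f \<in> pts (lip_space Y real_line)" "g \<in> pts (lip_space Y real_line)" for f g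
      using that L.add_in[OF that] by (auto simp: precomp_def op_add_def compose_def R fun_eq_iff)
    show "precomp X Y R (scl (lip_space Y real_line) a f)
        = scl (lip_space X real_line) a (precomp X Y R f)"
      if "f \<in> pts (lip_space Y real_line)" for a f
      using that L.scl_in[OF that, of a] by (auto simp: precomp_def op_scl_def compose_def R fun_eq_iff)
    show "nrm (lip_space X real_line) (precomp X Y R f)
        \<le> lip_norm X Y R * nrm (lip_space Y real_line) f"
      if "f \<in> pts (lip_space Y real_line)" for f
      using lip_norm_compose[OF assms(1,2) normed_space_on_real_line assms(3), of f] that
      by (simp add: precomp_def mult.commute)
  qed
qed

lemma delta_in_dual:
  assumes "normed_space_on X" "x \<in> pts X"
  shows "delta X x \<in> bdd_ops (lip_space X real_line) real_line"
proof -
  interpret normed_space_on X by fact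
  interpret L: normed_space_on "lip_space X real_line"
    by (rule normed_space_on_lip_space) fact
  show ?thesis
  proof (rule bdd_opsI[where C = "nrm X x"])
    show "nrm real_line (delta X x f) \<le> nrm X x * nrm (lip_space X real_line) f"
      if "f \<in> pts (lip_space X real_line)" for f
    proof -
      have f: "f \<in> lip_maps X real_line" using that by simp
      show ?thesis
        using lip_norm_bound[OF assms(1) normed_space_on_real_line f assms(2) zer_in] f
        by (simp add: delta_def lip_mapsD(3)[OF f] vdist_zer assms(2) mult.commute)
    qed
  qed (use L.add_in L.scl_in assms(2) in \<open>auto simp: delta_def op_add_def op_scl_def\<close>)
qed

lemma
  assumes "normed_space_on X"
  shows linear_subspace_free_space:
      "linear_subspace (dual_space (lip_space X real_line)) (pts (free_space X))"
    and banach_space_on_free_space: "banach_space_on (free_space X)"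
    and delta_in_free_space: "x \<in> pts X \<Longrightarrow> delta X x \<in> pts (free_space X)"
proof -
  let ?D = "dual_space (lip_space X real_line)"
  let ?S = "lspan ?D (delta X ` pts X)"
  have L: "normed_space_on (lip_space X real_line)" by (rule normed_space_on_lip_space) fact
  interpret D: banach_space_on ?D by (rule banach_space_on_dual_space[OF L])
  have B: "delta X ` pts X \<subseteq> pts ?D" using delta_in_dual[OF assms] by auto
  have S: "linear_subspace ?D ?S"
    by (rule linear_subspace_lspan[OF D.normed_space_on_axioms B])
  have pts: "pts (free_space X) = D.mtopology closure_of ?S"
    by (simp add: free_space_def Let_def)
  show sub: "linear_subspace ?D (pts (free_space X))"
    unfolding pts by (rule linear_subspace_closure[OF D.normed_space_on_axioms S])
  have "banach_space_on (subspace_of ?D (pts (free_space X)))"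
    by (rule banach_space_on_subspace_of[OF D.banach_space_on_axioms sub]) (simp add: pts)
  then show "banach_space_on (free_space X)"
    by (simp add: pts free_space_def Let_def)
  have "?S \<subseteq> pts (free_space X)"
    using S unfolding pts by (intro closure_of_subset) (simp only: D.topspace_mtopology linear_subspace_def)
  then show "x \<in> pts X \<Longrightarrow> delta X x \<in> pts (free_space X)"
    using lspan_superset[of "delta X ` pts X" ?D] by auto
qed

definition free_map ::
    "'a nspace \<Rightarrow> 'b nspace \<Rightarrow> ('a \<Rightarrow> 'b) \<Rightarrow> (('a \<Rightarrow> real) \<Rightarrow> real) \<Rightarrow> ('b \<Rightarrow> real) \<Rightarrow> real" where
  "free_map X Y R = restrict
     (adjoint (lip_space Y real_line) (lip_space X real_line) (precomp X Y R)) (pts (free_space X))"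

text \<open>
  The adjoint of \<open>h \<mapsto> h \<circ> R\<close> moves the evaluation at \<open>x\<close> to the evaluation at \<open>R x\<close>.  Hence it maps the
  span of the evaluations on \<open>X\<close> into that of the evaluations on \<open>Y\<close>, and by continuity the closure
  of the one into the closure of the other.
\<close>

lemma
  assumes "normed_space_on X" "normed_space_on Y" "R \<in> lip_maps X Y"
  shows free_map_delta: "x \<in> pts X \<Longrightarrow> free_map X Y R (delta X x) = delta Y (R x)"
    and free_map_bdd_ops: "free_map X Y R \<in> bdd_ops (free_space X) (free_space Y)"
proof -
  let ?LX = "lip_space X real_line" and ?LY = "lip_space Y real_line"
  let ?T = "adjoint ?LY ?LX (precomp X Y R)"
  have LX: "normed_space_on ?LX" and LY: "normed_space_on ?LY"
    by (simp_all add: normed_space_on_lip_space assms)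
  interpret DX: normed_space_on "dual_space ?LX" by (rule normed_space_on_dual_space[OF LX])
  interpret DY: normed_space_on "dual_space ?LY" by (rule normed_space_on_dual_space[OF LY])
  have T: "?T \<in> bdd_ops (dual_space ?LX) (dual_space ?LY)"
    by (intro adjoint_bdd_ops LX LY precomp_bdd_ops assms)
  have Td: "?T (delta X x) = delta Y (R x)" if "x \<in> pts X" for x
    using delta_in_dual[OF assms(1) that] lip_maps_compose[OF assms(1,2) normed_space_on_real_line assms(3)]
    by (auto simp: adjoint_def compose_def delta_def precomp_def that fun_eq_iff)
  then show "x \<in> pts X \<Longrightarrow> free_map X Y R (delta X x) = delta Y (R x)"
    using delta_in_free_space[OF assms(1)] by (simp add: free_map_def)
  have "?T ` lspan (dual_space ?LX) (delta X ` pts X) \<subseteq> lspan (dual_space ?LY) (delta Y ` pts Y)"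
    using lip_mapsD(2)[OF assms(3)] delta_in_dual[OF assms(1)]
    by (intro bdd_ops_lspan[OF DX.normed_space_on_axioms DY.normed_space_on_axioms T])
      (auto simp: Td)
  then have "DY.mtopology closure_of (?T ` lspan (dual_space ?LX) (delta X ` pts X))
      \<subseteq> DY.mtopology closure_of lspan (dual_space ?LY) (delta Y ` pts Y)"
    by (rule closure_of_mono)
  moreover have "continuous_map DX.mtopology DY.mtopology ?T"
    by (intro lip_maps_continuous bdd_ops_lip_maps T DX.normed_space_on_axioms DY.normed_space_on_axioms)
  ultimately have "?T ` pts (free_space X) \<subseteq> pts (free_space Y)"
    using continuous_map_image_closure_subset[of DX.mtopology DY.mtopology ?T]
    by (simp add: free_space_def Let_def) blast
  from bdd_ops_restrict[OF T linear_subspace_free_space[OF assms(1)] this]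
  show "free_map X Y R \<in> bdd_ops (free_space X) (free_space Y)"
    by (simp add: free_map_def free_space_def Let_def)
qed

section \<open>Operator ideals and Lipschitz operator ideals\<close>

lemma
  assumes "operator_ideal A"
  shows operator_ideal_add: "\<lbrakk>banach_space_on E; banach_space_on F; S \<in> A E F; T \<in> A E F\<rbrakk> \<Longrightarrow> op_add E F S T \<in> A E F"
    and operator_ideal_compose:
        "\<lbrakk>banach_space_on D; banach_space_on E; banach_space_on F; banach_space_on G;
          R \<in> bdd_ops D E; T \<in> A E F; S \<in> bdd_ops F G\<rbrakk>
          \<Longrightarrow> compose (pts D) S (compose (pts D) T R) \<in> A D G"
proof -
  note A = assms[unfolded operator_ideal_def]
  show "op_add E F S T \<in> A E F"
    if "banach_space_on E" "banach_space_on F" "S \<in> A E F" "T \<in> A E F"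
    using A[THEN conjunct1, THEN spec, THEN spec, THEN mp, OF conjI, OF that(1,2)] that(3,4) by simp
  show "compose (pts D) S (compose (pts D) T R) \<in> A D G"
    if "banach_space_on D" "banach_space_on E" "banach_space_on F" "banach_space_on G"
      "R \<in> bdd_ops D E" "T \<in> A E F" "S \<in> bdd_ops F G"
    using A[THEN conjunct2, THEN spec, of D, THEN spec, of E, THEN spec, of F, THEN spec, of G] that
    by simp
qed

lemma ideal_opsI:
  assumes "T \<in> bdd_ops E F" "banach_space_on E'" "isometric_iso E E' i"
    "banach_space_on F'" "isometric_iso F F' j" "T' \<in> A E' F'"
    "\<And>x. x \<in> pts E \<Longrightarrow> T' (i x) = j (T x)"
  shows "T \<in> ideal_ops A E F"
  unfolding ideal_ops_def mem_Collect_eq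
  by (intro conjI exI[of _ E'] exI[of _ F'] exI[of _ i] exI[of _ j] bexI[of _ T'] ballI assms)

lemma ideal_opsE:
  assumes "T \<in> ideal_ops A E F"
  obtains E' i F' j T' where "banach_space_on E'" "isometric_iso E E' i"
    "banach_space_on F'" "isometric_iso F F' j" "T' \<in> A E' F'"
    "\<forall>x\<in>pts E. T' (i x) = j (T x)"
  using assms unfolding ideal_ops_def mem_Collect_eq
  by (elim conjE exE bexE) (rule that)

text \<open>
  Membership of \<open>T\<close> in the ideal comes with some copies \<open>E'\<close>, \<open>F'\<close> of \<open>E\<close> and \<open>F\<close> that cannot be
  chosen.  Conjugating \<open>R\<close> and \<open>S\<close> with the isometries turns the composition \<open>S T R\<close> into one of
  \<open>D' \<rightarrow> E' \<rightarrow> F' \<rightarrow> G'\<close>, and the ideal property applies.  The copies \<open>D'\<close>, \<open>G'\<close> of the outer spaces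
  are arbitrary, so the case \<open>R = Id\<close>, \<open>S = Id\<close> says that the choice of copies is immaterial.
\<close>

lemma ideal_ops_compose_transport:
  assumes A: "operator_ideal A"
    and D: "normed_space_on D" and E: "normed_space_on E"
    and F: "normed_space_on F" and G: "normed_space_on G"
    and R: "R \<in> bdd_ops D E" and T: "T \<in> ideal_ops A E F" and S: "S \<in> bdd_ops F G"
    and D': "banach_space_on D'" "isometric_iso D D' i"
    and G': "banach_space_on G'" "isometric_iso G G' j"
  shows "\<exists>T'\<in>A D' G'. \<forall>x\<in>pts D. T' (i x) = j (S (T (R x)))"
proof -
  obtain E' k F' l T0 where E': "banach_space_on E'" "isometric_iso E E' k"
    and F': "banach_space_on F'" "isometric_iso F F' l"
    and T0: "T0 \<in> A E' F'" "\<forall>x\<in>pts E. T0 (k x) = l (T x)"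
    using T by (rule ideal_opsE)
  interpret D': banach_space_on D' by fact
  interpret F': banach_space_on F' by fact
  let ?i = "\<lambda>y\<in>pts D'. inv_into (pts D) i y" and ?l = "\<lambda>y\<in>pts F'. inv_into (pts F) l y"
  let ?R = "compose (pts D') (compose (pts D) k R) ?i"
  let ?S = "compose (pts F') (compose (pts F) j S) ?l"
  have k: "k \<in> bdd_ops E E'" and l: "l \<in> bdd_ops F F'" and j: "j \<in> bdd_ops G G'"
    and i: "i \<in> bdd_ops D D'"
    using E' F' D' G' by (simp_all add: isometric_iso_def)
  have Tb: "T \<in> bdd_ops E F" using T by (simp add: ideal_ops_def)
  have "bij_betw i (pts D) (pts D')" "bij_betw l (pts F) (pts F')"
    using D' F' by (simp_all add: isometric_iso_def)
  then have inv: "\<And>x. x \<in> pts D \<Longrightarrow> ?i (i x) = x" "\<And>x. x \<in> pts F \<Longrightarrow> ?l (l x) = x"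
    by (simp_all add: bij_betw_inv_into_left bdd_opsD[OF i] bdd_opsD[OF l])
  have "?R \<in> bdd_ops D' E'"
    by (rule bdd_ops_compose[OF D'.normed_space_on_axioms D isometric_iso_inverse[OF D D'(2)]
          bdd_ops_compose[OF D E R k]])
  moreover have "?S \<in> bdd_ops F' G'"
    by (rule bdd_ops_compose[OF F'.normed_space_on_axioms F isometric_iso_inverse[OF F F'(2)]
          bdd_ops_compose[OF F G S j]])
  ultimately have "compose (pts D') ?S (compose (pts D') T0 ?R) \<in> A D' G'"
    by (intro operator_ideal_compose[OF A D'(1) E'(1) F'(1) G'(1)] T0(1))
  then show ?thesis
  proof (rule bexI[rotated], intro ballI)
    show "compose (pts D') ?S (compose (pts D') T0 ?R) (i x) = j (S (T (R x)))"
      if x: "x \<in> pts D" for x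
    proof -
      have Rx: "R x \<in> pts E" "T (R x) \<in> pts F" "i x \<in> pts D'" "l (T (R x)) \<in> pts F'"
        by (simp_all add: bdd_opsD[OF R] bdd_opsD[OF Tb] bdd_opsD[OF i] bdd_opsD[OF l] x)
      have "compose (pts D') ?S (compose (pts D') T0 ?R) (i x) = ?S (compose (pts D') T0 ?R (i x))"
        by (rule compose_eq[OF Rx(3)])
      also have "compose (pts D') T0 ?R (i x) = l (T (R x))"
        unfolding compose_eq[OF Rx(3)] inv(1)[OF x] by (simp add: compose_eq x T0(2) Rx)
      also have "?S (l (T (R x))) = j (S (T (R x)))"
        unfolding compose_eq[OF Rx(4)] inv(2)[OF Rx(2)] by (simp add: compose_eq Rx)
      finally show ?thesis .
    qed
  qed
qed

lemma ideal_ops_compose: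
  fixes A :: "'u op_class" and D :: "'a nspace" and G :: "'b nspace"
    and k :: "'a \<Rightarrow> 'u" and l :: "'b \<Rightarrow> 'u"
  assumes A: "operator_ideal A" and k: "inj k" and l: "inj l"
    and D: "banach_space_on D" and E: "normed_space_on E" and F: "normed_space_on F"
    and G: "banach_space_on G"
    and R: "R \<in> bdd_ops D E" and T: "T \<in> ideal_ops A E F" and S: "S \<in> bdd_ops F G"
  shows "compose (pts D) S (compose (pts D) T R) \<in> ideal_ops A D G"
proof -
  interpret D: banach_space_on D by fact
  interpret G: banach_space_on G by fact
  note D' = banach_space_on_transport_space[OF D k] isometric_iso_transport_space[OF D k]
    and G' = banach_space_on_transport_space[OF G l] isometric_iso_transport_space[OF G l]
  obtain T' where T': "T' \<in> A (transport_space k D) (transport_space l G)"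
    "\<And>x. x \<in> pts D \<Longrightarrow> T' (restrict k (pts D) x) = restrict l (pts G) (S (T (R x)))"
    using ideal_ops_compose_transport[OF A D.normed_space_on_axioms E F
        G.normed_space_on_axioms R T S D' G'] by (elim bexE) simp
  have "T \<in> bdd_ops E F" using T by (simp add: ideal_ops_def)
  then have "compose (pts D) S (compose (pts D) T R) \<in> bdd_ops D G"
    by (rule bdd_ops_compose[OF D.normed_space_on_axioms F
          bdd_ops_compose[OF D.normed_space_on_axioms E R] S])
  then show ?thesis
    by (rule ideal_opsI[OF _ D' G']) (rule T'(1), simp only: compose_eq T'(2))
qed

lemma bdd_ops_id:
  assumes "normed_space_on E"
  shows "(\<lambda>x\<in>pts E. x) \<in> bdd_ops E E"
proof -
  interpret normed_space_on E by fact
  show ?thesis by (rule bdd_opsI[where C = 1]) (auto simp: add_in scl_in)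
qed

text \<open>
  The ideal is closed under sums of operators between the same two spaces only, so the second
  operator is first moved to the copies that witness the membership of the first.
\<close>

lemma ideal_ops_add:
  assumes A: "operator_ideal A" and E: "normed_space_on E" and F: "normed_space_on F"
    and S: "S \<in> ideal_ops A E F" and T: "T \<in> ideal_ops A E F"
  shows "op_add E F S T \<in> ideal_ops A E F"
proof -
  obtain E' i F' j S' where E': "banach_space_on E'" "isometric_iso E E' i"
    and F': "banach_space_on F'" "isometric_iso F F' j"
    and S': "S' \<in> A E' F'" "\<forall>x\<in>pts E. S' (i x) = j (S x)"
    using S by (rule ideal_opsE)
  have b: "S \<in> bdd_ops E F" "T \<in> bdd_ops E F" using S T by (simp_all add: ideal_ops_def)
  obtain T' where T': "T' \<in> A E' F'"
    "\<And>x. x \<in> pts E \<Longrightarrow> T' (i x) = j ((\<lambda>x\<in>pts F. x) (T ((\<lambda>x\<in>pts E. x) x)))"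
    using ideal_ops_compose_transport[OF A E E F F bdd_ops_id[OF E] T bdd_ops_id[OF F] E' F'] by (elim bexE) simp
  have i: "i \<in> bdd_ops E E'" and j: "j \<in> bdd_ops F F'"
    using E' F' by (simp_all add: isometric_iso_def)
  have "op_add E' F' S' T' \<in> A E' F'"
    by (intro operator_ideal_add[OF A] E' F' S' T')
  moreover have "op_add E' F' S' T' (i x) = j (op_add E F S T x)" if "x \<in> pts E" for x
    using that by (simp add: op_add_def S' T' bdd_opsD[OF i] bdd_opsD[OF j] bdd_opsD[OF b(1)] bdd_opsD[OF b(2)])
  ultimately show ?thesis
    using bdd_ops_add[OF E F b] E' F' by (intro ideal_opsI)
qed

text \<open>
  The linearization of \<open>S f R\<close> is \<open>S L\<^sub>f R'\<close>, where \<open>R' : \<FF>(X) \<rightarrow> \<FF>(Y)\<close> is the linear extension of \<open>R\<close>.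
  Hence \<open>R\<close> may be any Lipschitz map with \<open>R 0 = 0\<close>, while \<open>S\<close> has to be linear.
\<close>

lemma lip_ideal_compose:
  fixes A :: "'u op_class" and X :: "'a nspace" and W :: "'b nspace"
    and k :: "(('a \<Rightarrow> real) \<Rightarrow> real) \<Rightarrow> 'u" and l :: "'b \<Rightarrow> 'u"
  assumes A: "operator_ideal A" and k: "inj k" and l: "inj l"
    and X: "normed_space_on X" and Y: "normed_space_on Y" and Z: "normed_space_on Z"
    and W: "banach_space_on W"
    and R: "R \<in> lip_maps X Y" and f: "f \<in> lip_ideal A Y Z" and S: "S \<in> bdd_ops Z W"
  shows "compose (pts X) S (compose (pts X) f R) \<in> lip_ideal A X W"
proof -
  interpret W: banach_space_on W by fact
  interpret FX: banach_space_on "free_space X" by (rule banach_space_on_free_space[OF X])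
  interpret FY: banach_space_on "free_space Y" by (rule banach_space_on_free_space[OF Y])
  obtain L where L: "L \<in> ideal_ops A (free_space Y) Z" "\<And>y. y \<in> pts Y \<Longrightarrow> L (delta Y y) = f y"
    and f': "f \<in> lip_maps Y Z"
    using f by (auto simp: lip_ideal_def is_linearization_def)
  let ?L = "compose (pts (free_space X)) S (compose (pts (free_space X)) L (free_map X Y R))"
  have *: "?L \<in> ideal_ops A (free_space X) W"
    by (intro ideal_ops_compose[OF A k l FX.banach_space_on_axioms FY.normed_space_on_axioms Z W]
        free_map_bdd_ops X Y R L(1) S)
  have "is_linearization X W (compose (pts X) S (compose (pts X) f R)) ?L"
    using * delta_in_free_space[OF X] lip_mapsD(2)[OF R]
    by (auto simp: is_linearization_def ideal_ops_def compose_eq free_map_delta[OF X Y R] L(2))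
  moreover have "compose (pts X) S (compose (pts X) f R) \<in> lip_maps X W"
    by (intro lip_maps_compose[OF X Z W.normed_space_on_axioms] lip_maps_compose[OF X Y Z R f']
        bdd_ops_lip_maps[OF Z W.normed_space_on_axioms S])
  ultimately show ?thesis using * by (auto simp: lip_ideal_def)
qed

lemma
  assumes X: "normed_space_on X" and Y: "normed_space_on Y"
    and f: "f \<in> lip_maps X Y" and g: "g \<in> lip_maps X Y"
  shows lip_maps_add: "op_add X Y f g \<in> lip_maps X Y"
    and lip_norm_add: "lip_norm X Y (op_add X Y f g) \<le> lip_norm X Y f + lip_norm X Y g"
proof -
  interpret X: normed_space_on X by fact
  interpret Y: normed_space_on Y by fact
  note fD = lip_mapsD[OF f] and gD = lip_mapsD[OF g]
  let ?C = "lip_norm X Y f + lip_norm X Y g"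
  have le: "vdist Y (op_add X Y f g x) (op_add X Y f g y) \<le> ?C * vdist X x y"
    if "x \<in> pts X" "y \<in> pts X" for x y
    using Y.vdist_add_add[of "f x" "g x" "f y" "g y"] lip_norm_bound[OF X Y f that]
      lip_norm_bound[OF X Y g that] that
    by (simp add: op_add_def fD gD distrib_right)
  show "op_add X Y f g \<in> lip_maps X Y"
    using le by (intro lip_mapsI[where C = ?C])
      (auto simp: op_add_def fD gD Y.add_in X.zer_in Y.zer_in Y.add_zer)
  show "lip_norm X Y (op_add X Y f g) \<le> ?C"
    using le by (intro lip_norm_least[OF X])
      (auto simp: lip_norm_nonneg[OF X Y f] lip_norm_nonneg[OF X Y g])
qed

lemma lip_ideal_add:
  assumes A: "operator_ideal A" and X: "normed_space_on X" and Y: "normed_space_on Y"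
    and f: "f \<in> lip_ideal A X Y" and g: "g \<in> lip_ideal A X Y"
  shows "op_add X Y f g \<in> lip_ideal A X Y"
proof -
  interpret FX: banach_space_on "free_space X" by (rule banach_space_on_free_space[OF X])
  obtain S where S: "S \<in> ideal_ops A (free_space X) Y" "\<And>x. x \<in> pts X \<Longrightarrow> S (delta X x) = f x"
    using f by (auto simp: lip_ideal_def is_linearization_def)
  obtain T where T: "T \<in> ideal_ops A (free_space X) Y" "\<And>x. x \<in> pts X \<Longrightarrow> T (delta X x) = g x"
    using g by (auto simp: lip_ideal_def is_linearization_def)
  have ST: "op_add (free_space X) Y S T \<in> ideal_ops A (free_space X) Y"
    by (intro ideal_ops_add A FX.normed_space_on_axioms Y S T)
  then have "is_linearization X Y (op_add X Y f g) (op_add (free_space X) Y S T)"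
    using delta_in_free_space[OF X]
    by (auto simp: is_linearization_def ideal_ops_def op_add_def S T)
  then show ?thesis
    using ST f g lip_maps_add[OF X Y] by (auto simp: lip_ideal_def)
qed

section \<open>The compact-open topology and the approximation property\<close>

lemma openin_tau_c:
  "openin (tau_c X Y) U \<longleftrightarrow> U \<subseteq> cont_maps X Y \<and>
     (\<forall>f\<in>U. \<exists>K e. compactin (vtop X) K \<and> 0 < e \<and> uc_nbhd X Y f K e \<subseteq> U)"
  unfolding tau_c_def by (subst topology_inverse'[OF istopology_tau_c]) (rule refl)

lemma topspace_tau_c: "topspace (tau_c X Y) = cont_maps X Y"
proof -
  have "openin (tau_c X Y) (cont_maps X Y)"
    unfolding openin_tau_c
  proof (intro conjI subset_refl ballI exI)
    show "compactin (vtop X) {}" "(0::real) < 1" by simp_all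
    show "uc_nbhd X Y f {} 1 \<subseteq> cont_maps X Y" for f by (auto simp: uc_nbhd_def)
  qed
  moreover have "topspace (tau_c X Y) \<subseteq> cont_maps X Y"
    using openin_topspace[of "tau_c X Y"] unfolding openin_tau_c by (rule conjunct1)
  ultimately show ?thesis
    using openin_subset by (intro subset_antisym)
qed

text \<open>
  The sets \<open>uc_nbhd X Y f K e\<close> define the topology, but that they are neighbourhoods of \<open>f\<close> is not part
  of the definition.
\<close>

lemma in_closure_of_tau_c:
  assumes X: "normed_space_on X" and Y: "normed_space_on Y"
    and f: "f \<in> cont_maps X Y" and S: "S \<subseteq> cont_maps X Y"
  shows "f \<in> tau_c X Y closure_of S \<longleftrightarrow>
    (\<forall>K e. compactin (vtop X) K \<longrightarrow> 0 < e \<longrightarrow> (\<exists>g\<in>S. \<forall>x\<in>K. vdist Y (g x) (f x) < e))"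
    (is "_ = ?R")
proof
  interpret X: normed_space_on X by fact
  interpret Y: normed_space_on Y by fact
  assume cl: "f \<in> tau_c X Y closure_of S"
  show ?R
  proof safe
    fix K and e :: real assume K: "compactin (vtop X) K" and e: "0 < e"
    have KX: "x \<in> pts X" if "x \<in> K" for x
      using compactin_subset_topspace[OF K] that by auto
    have Y_in: "g x \<in> pts Y" if "g \<in> cont_maps X Y" "x \<in> K" for g x
      using that KX by (auto simp: cont_maps_def)
    (* A bound d < e that is uniform on K leaves the room (e - d) / 2 around each map of U,
       whereas a pointwise bound by e need not. *)
    define U where "U = {g \<in> cont_maps X Y. \<exists>d<e. \<forall>x\<in>K. vdist Y (g x) (f x) \<le> d}"
    have "openin (tau_c X Y) U"
      unfolding openin_tau_c
    proof (intro conjI ballI)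
      show "U \<subseteq> cont_maps X Y" by (auto simp: U_def)
      fix g assume "g \<in> U"
      then obtain d where g: "g \<in> cont_maps X Y" "d < e" "\<And>x. x \<in> K \<Longrightarrow> vdist Y (g x) (f x) \<le> d"
        by (auto simp: U_def)
      have "h \<in> U" if h: "h \<in> uc_nbhd X Y g K ((e - d) / 2)" for h
      proof -
        have "vdist Y (h x) (f x) \<le> (e + d) / 2" if x: "x \<in> K" for x
        proof -
          have "vdist Y (h x) (g x) < (e - d) / 2" using h x by (simp add: uc_nbhd_def)
          moreover have "vdist Y (h x) (f x) \<le> vdist Y (h x) (g x) + vdist Y (g x) (f x)"
            using h by (intro Y.triangle Y_in x g(1) f) (simp add: uc_nbhd_def)
          moreover have "vdist Y (g x) (f x) \<le> d" by (rule g(3)[OF x])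
          ultimately show ?thesis by (simp add: field_simps)
        qed
        moreover have "(e + d) / 2 < e" using g(2) by simp
        ultimately show ?thesis using h unfolding U_def uc_nbhd_def by blast
      qed
      then show "\<exists>L c. compactin (vtop X) L \<and> 0 < c \<and> uc_nbhd X Y g L c \<subseteq> U"
        using K g(2) by (intro exI[of _ K] exI[of _ "(e - d) / 2"]) auto
    qed
    moreover have "f \<in> U"
      using f e by (auto simp: U_def Y.mdist_zero Y_in[OF f] intro!: exI[of _ 0])
    ultimately obtain g where "g \<in> S" "g \<in> U" using cl by (meson in_closure_of)
    then show "\<exists>g\<in>S. \<forall>x\<in>K. vdist Y (g x) (f x) < e"
      by (force simp: U_def)
  qed
next
  assume R: ?R
  show "f \<in> tau_c X Y closure_of S"
    unfolding in_closure_of topspace_tau_c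
  proof (intro conjI f allI impI)
    fix U assume "f \<in> U \<and> openin (tau_c X Y) U"
    then obtain K e where "compactin (vtop X) K" "0 < e" "uc_nbhd X Y f K e \<subseteq> U"
      unfolding openin_tau_c by metis
    then show "\<exists>g. g \<in> S \<and> g \<in> U"
      using R S unfolding uc_nbhd_def by blast
  qed
qed

lemma lip_bap_iff:
  assumes "normed_space_on Z"
  shows "lip_bap A Z \<longleftrightarrow> (\<exists>r\<ge>1. \<forall>K e. compactin (vtop Z) K \<longrightarrow> 0 < e \<longrightarrow>
    (\<exists>g\<in>lip_ideal_ball A r Z Z. \<forall>x\<in>K. vdist Z (g x) x < e))"
proof -
  interpret normed_space_on Z by fact
  have cont: "lip_maps Z Z \<subseteq> cont_maps Z Z"
    using lip_maps_continuous[OF assms assms] by (auto simp: cont_maps_def lip_maps_def)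
  have id: "(\<lambda>x\<in>pts Z. x) \<in> cont_maps Z Z"
    using cont bdd_ops_lip_maps[OF assms assms bdd_ops_id[OF assms]] by blast
  have "lip_ideal_ball A r Z Z \<subseteq> cont_maps Z Z" for r
    using cont by (auto simp: lip_ideal_ball_def lip_ideal_def)
  note closure = in_closure_of_tau_c[OF assms assms id this]
  have "(\<exists>g\<in>S. \<forall>x\<in>K. vdist Z (g x) ((\<lambda>x\<in>pts Z. x) x) < e) \<longleftrightarrow>
      (\<exists>g\<in>S. \<forall>x\<in>K. vdist Z (g x) x < e)"
    if "compactin mtopology K" for S K and e :: real
  proof -
    have "x \<in> pts Z" if "x \<in> K" for x
      using compactin_subset_topspace[OF \<open>compactin mtopology K\<close>] that by auto
    then show ?thesis by (intro bex_cong ball_cong refl) simp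
  qed
  then have "(compactin mtopology K \<longrightarrow> 0 < e \<longrightarrow>
        (\<exists>g\<in>S. \<forall>x\<in>K. vdist Z (g x) ((\<lambda>x\<in>pts Z. x) x) < e)) \<longleftrightarrow>
      (compactin mtopology K \<longrightarrow> 0 < e \<longrightarrow> (\<exists>g\<in>S. \<forall>x\<in>K. vdist Z (g x) x < e))"
    for S K and e :: real
    by (intro imp_cong refl)
  then show ?thesis
    unfolding lip_bap_def closure by (simp only:)
qed

text \<open>
  For Lipschitz maps \<open>f\<close>, \<open>g\<close> of the ideal on \<open>Y\<close> and \<open>Z\<close>, the map \<open>h = S f R + T g Q\<close> is in the ideal
  and differs from \<open>Id = S R + T Q\<close> at \<open>x\<close> by at most
  \<open>\<parallel>S\<parallel> \<parallel>f(R x) - R x\<parallel> + \<parallel>T\<parallel> \<parallel>g(Q x) - Q x\<parallel>\<close>.  The compact sets on which \<open>f\<close> and \<open>g\<close> must be close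
  to the identity are \<open>R(K)\<close> and \<open>Q(K)\<close>.  The bound on the Lipschitz norm of \<open>h\<close> does not depend on
  \<open>K\<close> and the precision.
\<close>

lemma lip_bap_of_decomposition:
  fixes A :: "'u op_class" and X :: "'a nspace" and \<iota> :: "(('a \<Rightarrow> real) \<Rightarrow> real) \<Rightarrow> 'u"
  assumes \<iota>: "inj \<iota>" and A: "operator_ideal A" and X: "banach_space_on X"
    and Y: "normed_space_on Y" "lip_bap A Y" and Z: "normed_space_on Z" "lip_bap A Z"
    and R: "R \<in> bdd_ops X Y" and S: "S \<in> bdd_ops Y X"
    and Q: "Q \<in> bdd_ops X Z" and T: "T \<in> bdd_ops Z X"
    and id: "\<And>x. x \<in> pts X \<Longrightarrow> add X (S (R x)) (T (Q x)) = x"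
  shows "lip_bap A X"
proof -
  interpret X: banach_space_on X by fact
  interpret Y: normed_space_on Y by fact
  interpret Z: normed_space_on Z by fact
  note nX = X.normed_space_on_axioms
  note RD = bdd_opsD[OF R] and SD = bdd_opsD[OF S] and QD = bdd_opsD[OF Q] and TD = bdd_opsD[OF T]
  have RL: "R \<in> lip_maps X Y" and SL: "S \<in> lip_maps Y X"
    and QL: "Q \<in> lip_maps X Z" and TL: "T \<in> lip_maps Z X"
    using bdd_ops_lip_maps nX Y(1) Z(1) R S Q T by blast+
  (* The points of X are embedded as their evaluations; those of the free space directly. *)
  have \<iota>': "inj (\<lambda>x. \<iota> (\<lambda>h. h x))"
  proof (rule injI)
    fix x y :: 'a
    assume "\<iota> (\<lambda>h. h x) = \<iota> (\<lambda>h. h y)"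
    then have "(\<lambda>h::'a \<Rightarrow> real. h x) = (\<lambda>h. h y)" using \<iota> by (rule injD[rotated])
    from fun_cong[OF this, of "\<lambda>z. if z = x then 1 else 0"] show "x = y" by (simp split: if_splits)
  qed
  obtain r where r: "1 \<le> r" and bap_Y: "\<And>K e. \<lbrakk>compactin (vtop Y) K; 0 < e\<rbrakk>
      \<Longrightarrow> \<exists>g\<in>lip_ideal_ball A r Y Y. \<forall>y\<in>K. vdist Y (g y) y < e"
    using Y(2) lip_bap_iff[OF Y(1), of A] by blast
  obtain s where s: "1 \<le> s" and bap_Z: "\<And>K e. \<lbrakk>compactin (vtop Z) K; 0 < e\<rbrakk>
      \<Longrightarrow> \<exists>g\<in>lip_ideal_ball A s Z Z. \<forall>z\<in>K. vdist Z (g z) z < e"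
    using Z(2) lip_bap_iff[OF Z(1), of A] by blast
  obtain C where C: "0 \<le> C"
    "\<And>x y. \<lbrakk>x \<in> pts Y; y \<in> pts Y\<rbrakk> \<Longrightarrow> vdist X (S x) (S y) \<le> C * vdist Y x y"
    using bdd_ops_vdist[OF Y(1) S] by blast
  obtain B where B: "0 \<le> B"
    "\<And>x y. \<lbrakk>x \<in> pts Z; y \<in> pts Z\<rbrakk> \<Longrightarrow> vdist X (T x) (T y) \<le> B * vdist Z x y"
    using bdd_ops_vdist[OF Z(1) T] by blast
  (* The maximum is there because the bound in the approximation property has to be at least 1. *)
  let ?t = "max 1 (lip_norm Y X S * (r * lip_norm X Y R) + lip_norm Z X T * (s * lip_norm X Z Q))"
  have "\<exists>g\<in>lip_ideal_ball A ?t X X. \<forall>x\<in>K. vdist X (g x) x < e"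
    if K: "compactin X.mtopology K" and e: "0 < e" for K e
  proof -
    have KX: "x \<in> pts X" if "x \<in> K" for x
      using compactin_subset_topspace[OF K] that by auto
    (* The summand 1 keeps the denominator positive if C = B = 0. *)
    define d where "d = e / (C + B + 1)"
    have d: "0 < d" "(C + B) * d < e"
      using e C(1) B(1) by (simp_all add: d_def field_simps)
    have "compactin Y.mtopology (R ` K)" "compactin Z.mtopology (Q ` K)"
      by (intro image_compactin[OF K] lip_maps_continuous nX Y(1) Z(1) RL QL)+
    then obtain f g where f: "f \<in> lip_ideal_ball A r Y Y" "\<forall>y\<in>R ` K. vdist Y (f y) y < d"
      and g: "g \<in> lip_ideal_ball A s Z Z" "\<forall>z\<in>Q ` K. vdist Z (g z) z < d"
      using bap_Y bap_Z d(1) by meson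
    have fI: "f \<in> lip_ideal A Y Y" "f \<in> lip_maps Y Y" "lip_norm Y Y f \<le> r"
      and gI: "g \<in> lip_ideal A Z Z" "g \<in> lip_maps Z Z" "lip_norm Z Z g \<le> s"
      using f(1) g(1) by (auto simp: lip_ideal_ball_def lip_ideal_def)
    let ?f = "compose (pts X) S (compose (pts X) f R)" and ?g = "compose (pts X) T (compose (pts X) g Q)"
    let ?h = "op_add X X ?f ?g"
    have "?f \<in> lip_ideal A X X" "?g \<in> lip_ideal A X X"
      using lip_ideal_compose[OF A \<iota> \<iota>' nX Y(1) Y(1) X RL fI(1) S]
        lip_ideal_compose[OF A \<iota> \<iota>' nX Z(1) Z(1) X QL gI(1) T] by simp_all
    then have h: "?h \<in> lip_ideal A X X" and fgL: "?f \<in> lip_maps X X" "?g \<in> lip_maps X X"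
      using lip_ideal_add[OF A nX nX] by (auto simp: lip_ideal_def)
    have nf: "lip_norm X X ?f \<le> lip_norm Y X S * (r * lip_norm X Y R)"
    proof -
      have "lip_norm X Y (compose (pts X) f R) \<le> lip_norm Y Y f * lip_norm X Y R"
        by (rule lip_norm_compose[OF nX Y(1) Y(1) RL fI(2)])
      also have "\<dots> \<le> r * lip_norm X Y R"
        by (intro mult_right_mono fI lip_norm_nonneg[OF nX Y(1) RL])
      finally have "lip_norm Y X S * lip_norm X Y (compose (pts X) f R) \<le> lip_norm Y X S * (r * lip_norm X Y R)"
        by (rule mult_left_mono) (rule lip_norm_nonneg[OF Y(1) nX SL])
      then show ?thesis
        using lip_norm_compose[OF nX Y(1) nX lip_maps_compose[OF nX Y(1) Y(1) RL fI(2)] SL]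
        by linarith
    qed
    have ng: "lip_norm X X ?g \<le> lip_norm Z X T * (s * lip_norm X Z Q)"
    proof -
      have "lip_norm X Z (compose (pts X) g Q) \<le> lip_norm Z Z g * lip_norm X Z Q"
        by (rule lip_norm_compose[OF nX Z(1) Z(1) QL gI(2)])
      also have "\<dots> \<le> s * lip_norm X Z Q"
        by (intro mult_right_mono gI lip_norm_nonneg[OF nX Z(1) QL])
      finally have "lip_norm Z X T * lip_norm X Z (compose (pts X) g Q) \<le> lip_norm Z X T * (s * lip_norm X Z Q)"
        by (rule mult_left_mono) (rule lip_norm_nonneg[OF Z(1) nX TL])
      then show ?thesis
        using lip_norm_compose[OF nX Z(1) nX lip_maps_compose[OF nX Z(1) Z(1) QL gI(2)] TL]
        by linarith
    qed
    have "lip_norm X X ?h \<le> ?t"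
      using lip_norm_add[OF nX nX fgL] nf ng by linarith
    then have "?h \<in> lip_ideal_ball A ?t X X"
      using h by (simp add: lip_ideal_ball_def)
    moreover have "vdist X (?h x) x < e" if x: "x \<in> K" for x
    proof -
      note xX = KX[OF x]
      have in_pts: "f (R x) \<in> pts Y" "g (Q x) \<in> pts Z"
        using lip_mapsD(2)[OF fI(2)] lip_mapsD(2)[OF gI(2)] RD(2)[OF xX] QD(2)[OF xX] by auto
      have "vdist X (?h x) x
          = vdist X (add X (S (f (R x))) (T (g (Q x)))) (add X (S (R x)) (T (Q x)))"
        using xX by (simp add: op_add_def compose_eq id)
      also have "\<dots> \<le> vdist X (S (f (R x))) (S (R x)) + vdist X (T (g (Q x))) (T (Q x))"
        by (intro X.vdist_add_add SD TD RD QD in_pts xX)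
      also have "\<dots> \<le> C * vdist Y (f (R x)) (R x) + B * vdist Z (g (Q x)) (Q x)"
        by (intro add_mono C(2) B(2) RD QD in_pts xX)
      also have "\<dots> \<le> C * d + B * d"
        using f(2) g(2) x by (intro add_mono mult_left_mono C(1) B(1)) (simp_all add: less_imp_le)
      also have "\<dots> < e" using d(2) by (simp add: distrib_right)
      finally show ?thesis .
    qed
    ultimately show ?thesis by blast
  qed
  then show ?thesis
    unfolding lip_bap_iff[OF nX] by (intro exI[of _ ?t]) simp
qed

section \<open>Quotients by kernels\<close>

lemma quotient_space_simps [simp]:
  "pts (quotient_space E M) = coset E M ` pts E" "zer (quotient_space E M) = M"
  "nrm (quotient_space E M) = (\<lambda>C. INF x\<in>C. nrm E x)"
  by (simp_all add: quotient_space_def)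

context
  fixes E :: "'a nspace" and M :: "'a set"
  assumes normed: "normed_space_on E" and M: "linear_subspace E M"
begin

interpretation normed_space_on E by (rule normed)

lemma subspace_closed:
  shows "m \<in> M \<Longrightarrow> m \<in> pts E" and "zer E \<in> M"
    and "\<lbrakk>m \<in> M; n \<in> M\<rbrakk> \<Longrightarrow> add E m n \<in> M" and "m \<in> M \<Longrightarrow> scl E a m \<in> M"
  using M by (auto simp: linear_subspace_def)

lemma coset_subset: "x \<in> pts E \<Longrightarrow> coset E M x \<subseteq> pts E"
  by (auto simp: coset_def add_in subspace_closed)

lemma in_coset_self: "x \<in> pts E \<Longrightarrow> x \<in> coset E M x"
  using subspace_closed(2) add_zer[of x] by (force simp: coset_def)

lemma in_coset_iff:
  assumes "x \<in> pts E" "y \<in> pts E"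
  shows "y \<in> coset E M x \<longleftrightarrow> vsub E y x \<in> M"
proof
  assume "y \<in> coset E M x"
  then obtain m where "m \<in> M" "y = add E x m" by (auto simp: coset_def)
  moreover from this have "vsub E y x = m"
    using assms by (simp add: vsub_def subspace_closed add_assoc add_left_commute[of x m] scl_in add_inv add_zer)
  ultimately show "vsub E y x \<in> M" by simp
next
  assume "vsub E y x \<in> M"
  then show "y \<in> coset E M x"
    using add_vsub_cancel[OF assms] by (force simp: coset_def)
qed

lemma coset_eq:
  assumes "x \<in> pts E" "y \<in> coset E M x"
  shows "coset E M y = coset E M x"
proof -
  have y: "y \<in> pts E" using assms coset_subset by blast
  have yx: "vsub E y x \<in> M" using assms y in_coset_iff by blast
  then have xy: "vsub E x y \<in> M" using vsub_swap[OF y assms(1)] subspace_closed(4) by simp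
  have "z \<in> coset E M y \<longleftrightarrow> z \<in> coset E M x" if "z \<in> pts E" for z
    using that assms(1) y vsub_trans[of z y x] vsub_trans[of z x y] subspace_closed(3) yx xy
    by (metis in_coset_iff)
  then show ?thesis using coset_subset assms(1) y by blast
qed

lemma add_coset:
  assumes "x \<in> pts E" "y \<in> pts E"
  shows "add (quotient_space E M) (coset E M x) (coset E M y) = coset E M (add E x y)"
proof -
  have "{add E u v |u v. u \<in> coset E M x \<and> v \<in> coset E M y} = coset E M (add E x y)"
  proof (intro subset_antisym subsetI)
    fix z assume "z \<in> {add E u v |u v. u \<in> coset E M x \<and> v \<in> coset E M y}"
    then obtain m n where "m \<in> M" "n \<in> M" "z = add E (add E x m) (add E y n)"
      by (auto simp: coset_def)
    then have "z = add E (add E x y) (add E m n)" "add E m n \<in> M"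
      using assms by (simp_all add: add_add_add_swap subspace_closed)
    then show "z \<in> coset E M (add E x y)" by (auto simp: coset_def)
  next
    fix z assume "z \<in> coset E M (add E x y)"
    then obtain m where "m \<in> M" "z = add E x (add E y m)"
      using assms by (auto simp: coset_def add_assoc subspace_closed)
    then show "z \<in> {add E u v |u v. u \<in> coset E M x \<and> v \<in> coset E M y}"
      using in_coset_self[OF assms(1)] by (auto simp: coset_def)
  qed
  then show ?thesis by (simp add: quotient_space_def)
qed

lemma scl_coset:
  assumes "x \<in> pts E"
  shows "scl (quotient_space E M) a (coset E M x) = coset E M (scl E a x)"
proof -
  have "{add E (scl E a u) m |u m. u \<in> coset E M x \<and> m \<in> M} = coset E M (scl E a x)"
  proof (intro subset_antisym subsetI)
    fix z assume "z \<in> {add E (scl E a u) m |u m. u \<in> coset E M x \<and> m \<in> M}"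
    then obtain m n where "m \<in> M" "n \<in> M" "z = add E (scl E a (add E x n)) m"
      by (auto simp: coset_def)
    then have "z = add E (scl E a x) (add E (scl E a n) m)" "add E (scl E a n) m \<in> M"
      using assms by (simp_all add: scl_add_right add_assoc scl_in subspace_closed)
    then show "z \<in> coset E M (scl E a x)" by (auto simp: coset_def)
  next
    fix z assume "z \<in> coset E M (scl E a x)"
    then show "z \<in> {add E (scl E a u) m |u m. u \<in> coset E M x \<and> m \<in> M}"
      using in_coset_self[OF assms] by (auto simp: coset_def)
  qed
  then show ?thesis by (simp add: quotient_space_def)
qed

lemma nrm_coset_le:
  assumes "x \<in> pts E" "y \<in> coset E M x"
  shows "nrm (quotient_space E M) (coset E M x) \<le> nrm E y"
proof -
  have "bdd_below (nrm E ` coset E M x)"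
    using coset_subset[OF assms(1)] nrm_nonneg by (intro bdd_belowI2[of _ 0]) blast
  then show ?thesis using assms(2) by (simp add: cINF_lower)
qed

lemma nrm_coset_greatest:
  assumes "x \<in> pts E" "\<And>y. y \<in> coset E M x \<Longrightarrow> c \<le> nrm E y"
  shows "c \<le> nrm (quotient_space E M) (coset E M x)"
  using in_coset_self[OF assms(1)] assms(2) by (auto intro!: cINF_greatest)

lemma coset_bdd_ops:
  "(\<lambda>x\<in>pts E. coset E M x) \<in> bdd_ops E (quotient_space E M)"
proof (rule bdd_opsI[where C = 1])
  show "nrm (quotient_space E M) ((\<lambda>x\<in>pts E. coset E M x) x) \<le> 1 * nrm E x" if "x \<in> pts E" for x
    using nrm_coset_le[OF that in_coset_self[OF that]] that by simp
qed (auto simp: add_coset scl_coset add_in scl_in)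

text \<open>
  The assumption expresses that \<open>M\<close> is closed.  All other norm properties follow from the fact that
  the quotient norm is the greatest lower bound of the norms of the representatives.
\<close>

lemma normed_space_on_quotient_space:
  assumes closed: "\<And>x. \<lbrakk>x \<in> pts E; nrm (quotient_space E M) (coset E M x) = 0\<rbrakk> \<Longrightarrow> x \<in> M"
  shows "normed_space_on (quotient_space E M)"
proof
  let ?Q = "quotient_space E M"
  have rep: "\<exists>x\<in>pts E. U = coset E M x" if "U \<in> pts ?Q" for U
    using that by auto
  have in_Q: "coset E M x \<in> pts ?Q" if "x \<in> pts E" for x using that by simp
  have zer: "zer ?Q = coset E M (zer E)"
    by (simp add: coset_def Setcompr_eq_image subspace_closed(1) zer_add)
  note ops = add_coset scl_coset zer add_in scl_in zer_in in_Q
  show "zer ?Q \<in> pts ?Q" by (simp only: ops)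
  show "add ?Q U V \<in> pts ?Q" if "U \<in> pts ?Q" "V \<in> pts ?Q" for U V
    using rep[OF that(1)] rep[OF that(2)] by (elim bexE) (simp only: ops)
  show "scl ?Q a U \<in> pts ?Q" if "U \<in> pts ?Q" for a U
    using rep[OF that] by (elim bexE) (simp only: ops)
  show "add ?Q (add ?Q U V) W = add ?Q U (add ?Q V W)"
    if "U \<in> pts ?Q" "V \<in> pts ?Q" "W \<in> pts ?Q" for U V W
    using rep[OF that(1)] rep[OF that(2)] rep[OF that(3)]
    by (elim bexE) (simp only: ops add_assoc)
  show "add ?Q U V = add ?Q V U" if "U \<in> pts ?Q" "V \<in> pts ?Q" for U V
    using rep[OF that(1)] rep[OF that(2)] by (elim bexE) (metis ops(1) add_commute)
  show "add ?Q U (zer ?Q) = U" if "U \<in> pts ?Q" for U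
    using rep[OF that] by (elim bexE) (simp only: ops add_zer)
  show "add ?Q U (scl ?Q (- 1) U) = zer ?Q" if "U \<in> pts ?Q" for U
    using rep[OF that] by (elim bexE) (simp only: ops add_inv)
  show "scl ?Q a (add ?Q U V) = add ?Q (scl ?Q a U) (scl ?Q a V)"
    if "U \<in> pts ?Q" "V \<in> pts ?Q" for a U V
    using rep[OF that(1)] rep[OF that(2)] by (elim bexE) (simp only: ops scl_add_right)
  show "scl ?Q (a + b) U = add ?Q (scl ?Q a U) (scl ?Q b U)" if "U \<in> pts ?Q" for a b U
    using rep[OF that] by (elim bexE) (simp only: ops scl_add_left)
  show "scl ?Q a (scl ?Q b U) = scl ?Q (a * b) U" if "U \<in> pts ?Q" for a b U
    using rep[OF that] by (elim bexE) (simp only: ops scl_scl)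
  show "scl ?Q 1 U = U" if "U \<in> pts ?Q" for U
    using rep[OF that] by (elim bexE) (simp only: ops scl_one)
  have nonneg: "0 \<le> nrm ?Q (coset E M x)" if "x \<in> pts E" for x
    using coset_subset[OF that] nrm_nonneg by (intro nrm_coset_greatest that) blast
  show "nrm ?Q U = 0 \<longleftrightarrow> U = zer ?Q" if U: "U \<in> pts ?Q" for U
  proof
    assume 0: "nrm ?Q U = 0"
    obtain x where x: "x \<in> pts E" "U = coset E M x" using rep[OF U] by blast
    then have "x \<in> M" using closed 0 by blast
    then have "x \<in> coset E M (zer E)" using zer by simp
    then show "U = zer ?Q" using coset_eq[OF zer_in] x zer by metis
  next
    assume "U = zer ?Q"
    then show "nrm ?Q U = 0"
      using nonneg[OF zer_in] nrm_coset_le[OF zer_in in_coset_self[OF zer_in]] unfolding zer nrm_zer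
      by (metis antisym)
  qed
  have scl_le: "nrm ?Q (coset E M (scl E a x)) \<le> \<bar>a\<bar> * nrm E y"
    if x: "x \<in> pts E" and y: "y \<in> coset E M x" for a x y
  proof -
    have yE: "y \<in> pts E" using coset_subset[OF x] y by blast
    have "coset E M (scl E a x) = coset E M (scl E a y)"
      using coset_eq[OF x y] scl_coset[OF x] scl_coset[OF yE] by metis
    then show ?thesis
      using nrm_coset_le[OF scl_in[OF yE] in_coset_self[OF scl_in[OF yE]], of a]
      by (simp only: nrm_scl yE)
  qed
  (* Homogeneity: only one inequality needs the infimum, the other is the same for 1 / a. *)
  have scl_le': "nrm ?Q (coset E M (scl E a x)) \<le> \<bar>a\<bar> * nrm ?Q (coset E M x)"
    if x: "x \<in> pts E" and a: "a \<noteq> 0" for a x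
  proof -
    have "nrm ?Q (coset E M (scl E a x)) / \<bar>a\<bar> \<le> nrm ?Q (coset E M x)"
      using scl_le[OF x, of _ a] a
      by (intro nrm_coset_greatest[OF x]) (simp add: divide_le_eq mult.commute del: quotient_space_simps)
    then show ?thesis using a by (simp add: divide_le_eq mult.commute del: quotient_space_simps)
  qed
  show "nrm ?Q (scl ?Q a U) = \<bar>a\<bar> * nrm ?Q U" if U: "U \<in> pts ?Q" for a U
  proof -
    obtain x where x: "x \<in> pts E" and Ux: "U = coset E M x" using rep[OF U] by blast
    show ?thesis
    proof (cases "a = 0")
      case True
      then show ?thesis
        using scl_le[OF x in_coset_self[OF x], of 0] nonneg[OF scl_in[OF x], of 0]
        unfolding Ux scl_coset[OF x] by (simp del: quotient_space_simps)
    next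
      case False
      have "nrm ?Q (coset E M x) \<le> \<bar>inverse a\<bar> * nrm ?Q (coset E M (scl E a x))"
        using scl_le'[OF scl_in[OF x], of "inverse a" a] False 
        by (simp only: scl_scl[OF x]) (simp add: scl_one[OF x] del: quotient_space_simps)
      then have "\<bar>a\<bar> * nrm ?Q (coset E M x) \<le> nrm ?Q (coset E M (scl E a x))"
        using False by (simp add: field_simps abs_inverse del: quotient_space_simps)
      then show ?thesis
        unfolding Ux scl_coset[OF x] using scl_le'[OF x False] by (rule antisym[rotated])
    qed
  qed
  show "nrm ?Q (add ?Q U V) \<le> nrm ?Q U + nrm ?Q V" if UV: "U \<in> pts ?Q" "V \<in> pts ?Q" for U V
  proof -
    obtain x y where x: "x \<in> pts E" "U = coset E M x" and y: "y \<in> pts E" "V = coset E M y"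
      using rep[OF UV(1)] rep[OF UV(2)] by blast
    have le: "nrm ?Q (add ?Q U V) \<le> nrm E u + nrm E v" if u: "u \<in> U" and v: "v \<in> V" for u v
    proof -
      have uv: "u \<in> pts E" "v \<in> pts E" using coset_subset x y u v by blast+
      have "U = coset E M u" "V = coset E M v" using coset_eq x y u v by blast+
      then have "add ?Q U V = coset E M (add E u v)" using add_coset[OF uv] by simp
      then show ?thesis
        using nrm_coset_le[OF add_in[OF uv] in_coset_self[OF add_in[OF uv]]] nrm_add[OF uv] by simp
    qed
    have "nrm ?Q (add ?Q U V) - nrm E u \<le> nrm ?Q V" if u: "u \<in> U" for u
      unfolding y(2) using le[OF u] y by (intro nrm_coset_greatest y(1)) (simp only: diff_le_eq add.commute)
    then have "nrm ?Q (add ?Q U V) - nrm ?Q V \<le> nrm ?Q U"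
      unfolding x(2) using x by (intro nrm_coset_greatest x(1)) (simp add: algebra_simps del: quotient_space_simps)
    then show ?thesis by simp
  qed
qed

end

lemma linear_subspace_range:
  assumes "normed_space_on E" "normed_space_on F" "T \<in> bdd_ops E F"
  shows "linear_subspace F (T ` pts E)"
proof -
  interpret normed_space_on E by fact
  note T = bdd_opsD[OF assms(3)]
  show ?thesis
    unfolding linear_subspace_def
  proof (intro conjI ballI allI)
    show "zer F \<in> T ` pts E" using bdd_ops_zer[OF assms] zer_in by (intro image_eqI[of _ _ "zer E"]) auto
    show "add F u v \<in> T ` pts E" if uv: "u \<in> T ` pts E" "v \<in> T ` pts E" for u v
    proof -
      obtain x y where "x \<in> pts E" "u = T x" "y \<in> pts E" "v = T y" using uv by blast
      then show ?thesis using add_in by (intro image_eqI[of _ _ "add E x y"]) (simp_all add: T)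
    qed
    show "scl F a u \<in> T ` pts E" if "u \<in> T ` pts E" for a u
    proof -
      obtain x where "x \<in> pts E" "u = T x" using \<open>u \<in> _\<close> by blast
      then show ?thesis using scl_in by (intro image_eqI[of _ _ "scl E a x"]) (simp_all add: T)
    qed
  qed (use T(2) in blast)
qed

text \<open>
  Since \<open>T\<close> is constant on each coset, \<open>\<parallel>T x\<parallel> \<le> C \<parallel>y\<parallel>\<close> for every representative \<open>y\<close> of the coset of \<open>x\<close>, so
  \<open>\<parallel>T x\<parallel>\<close> is bounded by the quotient norm.  This one estimate shows both that a coset of norm zero is
  the kernel itself and that the induced operator is bounded.
\<close>

lemma
  assumes E: "normed_space_on E" and F: "normed_space_on F" and T: "T \<in> bdd_ops E F"
    and M: "linear_subspace E M" and ker: "\<And>x. x \<in> pts E \<Longrightarrow> T x = zer F \<longleftrightarrow> x \<in> M"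
  shows normed_space_on_quotient_kernel: "normed_space_on (quotient_space E M)"
    and quotient_kernel_factor: "\<exists>S\<in>bdd_ops (quotient_space E M) F. \<forall>x\<in>pts E. S (coset E M x) = T x"
proof -
  interpret E: normed_space_on E by fact
  interpret F: normed_space_on F by fact
  let ?Q = "quotient_space E M"
  note TD = bdd_opsD[OF T]
  obtain C where C: "0 \<le> C" "\<And>x. x \<in> pts E \<Longrightarrow> nrm F (T x) \<le> C * nrm E x"
    using bdd_ops_bound[OF E T] by blast
  have const: "T y = T x" if x: "x \<in> pts E" and y: "y \<in> coset E M x" for x y
  proof -
    obtain m where m: "m \<in> M" "y = add E x m" using y by (auto simp: coset_def)
    moreover have "m \<in> pts E" using m M by (auto simp: linear_subspace_def)
    ultimately show ?thesis using x ker[of m] by (simp add: TD F.add_zer)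
  qed
  (* C + 1 is a positive bound, by which one can divide to pass to the infimum. *)
  have bound: "nrm F (T x) \<le> (C + 1) * nrm ?Q (coset E M x)" if x: "x \<in> pts E" for x
  proof -
    have "nrm F (T x) / (C + 1) \<le> nrm E y" if y: "y \<in> coset E M x" for y
    proof -
      have yE: "y \<in> pts E" using coset_subset[OF E M x] y by blast
      have "nrm F (T x) \<le> (C + 1) * nrm E y"
        using C(2)[OF yE] const[OF x y] E.nrm_nonneg[OF yE] by (simp add: distrib_right)
      then show ?thesis using C(1) by (simp add: divide_le_eq mult.commute)
    qed
    then have "nrm F (T x) / (C + 1) \<le> nrm ?Q (coset E M x)"
      by (rule nrm_coset_greatest[OF E M x])
    then show ?thesis using C(1) by (simp add: divide_le_eq mult.commute del: quotient_space_simps)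
  qed
  show "normed_space_on ?Q"
  proof (rule normed_space_on_quotient_space[OF E M])
    fix x assume x: "x \<in> pts E" and "nrm ?Q (coset E M x) = 0"
    then have "nrm F (T x) = 0"
      using bound[OF x] F.nrm_nonneg[OF TD(2)[OF x]] by (simp del: quotient_space_simps)
    then show "x \<in> M" using ker[OF x] F.nrm_zero_iff[OF TD(2)[OF x]] by simp
  qed
  define S where "S = (\<lambda>U\<in>pts ?Q. T (SOME y. y \<in> U))"
  have S: "S (coset E M x) = T x" if x: "x \<in> pts E" for x
  proof -
    have "(SOME y. y \<in> coset E M x) \<in> coset E M x"
      by (rule someI, rule in_coset_self[OF E M x])
    then show ?thesis using const[OF x] x by (simp add: S_def)
  qed
  have "S \<in> bdd_ops ?Q F"
  proof (rule bdd_opsI[where C = "C + 1"])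
    show "S \<in> pts ?Q \<rightarrow>\<^sub>E pts F"
    proof (rule PiE_I)
      show "S U \<in> pts F" if U: "U \<in> pts ?Q" for U
      proof -
        obtain x where "x \<in> pts E" "U = coset E M x" using U by auto
        then show ?thesis by (simp add: S TD(2))
      qed
      show "S U = undefined" if "U \<notin> pts ?Q" for U
        using that by (simp add: S_def)
    qed
    fix U assume "U \<in> pts ?Q"
    then obtain x where x: "x \<in> pts E" "U = coset E M x" by auto
    show "S (scl ?Q a U) = scl F a (S U)" for a
      using x by (simp add: scl_coset[OF E M] S E.scl_in TD)
    show "nrm F (S U) \<le> (C + 1) * nrm ?Q U"
      using bound[OF x(1)] by (simp only: x(2) S[OF x(1)])
    fix V assume "V \<in> pts ?Q"
    then obtain y where "y \<in> pts E" "V = coset E M y" by auto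
    then show "S (add ?Q U V) = add F (S U) (S V)"
      using x by (simp add: add_coset[OF E M] S E.add_in TD)
  qed
  then show "\<exists>S\<in>bdd_ops ?Q F. \<forall>x\<in>pts E. S (coset E M x) = T x"
    using S by blast
qed

section \<open>Complemented subspaces\<close>

theorem proposition4p3:
  fixes A :: "'u op_class"
    and X :: "'a nspace"
    and M :: "'a set"
    and \<iota> :: "(('a set \<Rightarrow> real) \<Rightarrow> real) \<Rightarrow> 'u"
  assumes universe: "inj \<iota>"
    and ideal: "operator_ideal A"
    and X: "banach_space_on X"
    and M: "complemented_subspace X M"
    and bap_M: "lip_bap A (subspace_of X M)"
    and bap_quot: "lip_bap A (quotient_space X M)"
  shows "lip_bap A X"
proof -
  interpret banach_space_on X by fact
  note nX = normed_space_on_axioms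
  obtain P where P: "P \<in> bdd_ops X X" and PP: "\<And>x. x \<in> pts X \<Longrightarrow> P (P x) = P x"
    and range: "P ` pts X = M"
    using M unfolding complemented_subspace_def by blast
  note PD = bdd_opsD[OF P]
  have lin: "linear_subspace X M"
    using linear_subspace_range[OF nX nX P] by (simp add: range)
  have M_iff: "x \<in> M \<longleftrightarrow> P x = x" if "x \<in> pts X" for x
    using that PP range by (metis image_iff)
  (* The complementary projection Id - P, whose kernel is M. *)
  let ?T = "op_add X X (\<lambda>x\<in>pts X. x) (compose (pts X) (\<lambda>x\<in>pts X. scl X (- 1) x) P)"
  have neg: "(\<lambda>x\<in>pts X. scl X (- 1) x) \<in> bdd_ops X X"
    by (rule bdd_opsI[where C = 1])
      (auto simp: add_in scl_in scl_add_right scl_scl nrm_scl)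
  have T: "?T \<in> bdd_ops X X"
    by (rule bdd_ops_add[OF nX nX bdd_ops_id[OF nX] bdd_ops_compose[OF nX nX P neg]])
  have T_eq: "?T x = vsub X x (P x)" if "x \<in> pts X" for x
    using that by (simp add: op_add_def compose_eq vsub_def PD)
  have ker: "?T x = zer X \<longleftrightarrow> x \<in> M" if "x \<in> pts X" for x
    using that by (auto simp: T_eq vsub_eq_zer_iff PD M_iff)
  obtain S where S: "S \<in> bdd_ops (quotient_space X M) X"
    and S_eq: "\<And>x. x \<in> pts X \<Longrightarrow> S (coset X M x) = vsub X x (P x)"
    using quotient_kernel_factor[OF nX nX T lin ker] T_eq by force
  have "P \<in> bdd_ops X (subspace_of X M)"
  proof -
    obtain C where "\<And>x. x \<in> pts X \<Longrightarrow> nrm X (P x) \<le> C * nrm X x"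
      using bdd_ops_bound[OF nX P] by blast
    then show ?thesis
      using PD range by (intro bdd_opsI[where C = C]) (auto simp: PiE_def)
  qed
  moreover have "restrict (\<lambda>x. x) M \<in> bdd_ops (subspace_of X M) X"
    using lin by (intro bdd_opsI[where C = 1]) (auto simp: linear_subspace_def)
  (* Functions on points are turned into functions on sets through singletons, which makes the
     universe large enough for the free space of X. *)
  moreover have "inj (\<lambda>\<phi> :: ('a \<Rightarrow> real) \<Rightarrow> real. \<iota> (\<lambda>h. \<phi> (\<lambda>x. h {x})))"
  proof (rule injI)
    fix \<phi> \<psi> :: "('a \<Rightarrow> real) \<Rightarrow> real"
    assume "\<iota> (\<lambda>h. \<phi> (\<lambda>x. h {x})) = \<iota> (\<lambda>h. \<psi> (\<lambda>x. h {x}))"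
    then have eq: "(\<lambda>h :: 'a set \<Rightarrow> real. \<phi> (\<lambda>x. h {x})) = (\<lambda>h. \<psi> (\<lambda>x. h {x}))"
      using universe by (rule injD[rotated])
    show "\<phi> = \<psi>"
    proof
      show "\<phi> f = \<psi> f" for f
        using fun_cong[OF eq, of "\<lambda>U. f (the_elem U)"] by simp
    qed
  qed
  moreover have "add X (restrict (\<lambda>x. x) M (P x)) (S ((\<lambda>x\<in>pts X. coset X M x) x)) = x"
    if "x \<in> pts X" for x
    using that range by (auto simp: S_eq PD add_vsub_cancel)
  ultimately show ?thesis
    by (intro lip_bap_of_decomposition[OF _ ideal X normed_space_on_subspace_of[OF nX lin] bap_M
          normed_space_on_quotient_kernel[OF nX nX T lin ker] bap_quot _ _
          coset_bdd_ops[OF nX lin] S])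
qed

end
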